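(* Let $(\Omega,\mathscr{H},\widehat{\mathbb E})$ be a sub-linear expectation space over a measurable space $(\Omega,\mathcal F)$, with upper capacity $\mathbb V$. Let $\{X_n;n\ge 1\}$ be a sequence of independent random variables in $(\Omega,\mathscr{H},\widehat{\mathbb E})$ and $S_n=\sum_{k=1}^n X_k$. (i) If there is a random variable $S$ on the measurable space $(\Omega,\mathcal F)$ such that $\mathbb V(|S_n-S|\ge\epsilon)\to0$ as $n\to\infty$ for all $\epsilon>0$, and $S$ is tight under $\widehat{\mathbb E}$, i.e. $\mathbb V(|S|>x)\to0$ as $x\to\infty$, then $$\widehat{\mathbb E}[\phi(S_n)]\to\widehat{\mathbb E}[\phi(S)]\quad\text{for all }\phi\in C_b(\mathbb R).$$ (ii) Suppose that there are a sub-linear expectation space $(\widetilde\Omega,\widetilde{\mathscr{H}},\widetilde{\mathbb E})$ and a random variable $\widetilde S$ on it such that $\widetilde S$ is tight under $\widetilde{\mathbb E}$, i.e. $\widetilde{\mathbb V}(|\widetilde S|>x)\to0$ as $x\to\infty$, and $$\widehat{\mathbb E}[\phi(S_n)]\to\widetilde{\mathbb E}[\phi(\widetilde S)]\quad\text{for all }\phi\in C_b(\mathbb R).$$ Then $S_n$ is a Cauchy sequence in capacity $\mathbb V$, namely $$\mathbb V(|S_n-S_m|\ge\epsilon)\to0\ \text{ as } n,m\to\infty,\ \text{ for all }\epsilon>0.$$ Furthermore, if $\mathbb V$ is countably sub-additive, then there is a random variable $S$ on the measurable space $(\Omega,\mathcal F)$, tight under $\widehat{\mathbb E}$, such that $\mathbb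 V(|S_n-S|\ge\epsilon)\to0$ as $n\to\infty$ for all $\epsilon>0$, and $\mathbb V\big(\{\omega:\lim_{n\to\infty}S_n(\omega)\ne S(\omega)\}\big)=0$.
   Context: Framework. $(\Omega,\mathcal F)$ is a measurable space and $\mathscr{H}$ is a linear space of real ($\mathcal F$-measurable) functions on $\Omega$ such that $X_1,\dots,X_n\in\mathscr{H}$ implies $\varphi(X_1,\dots,X_n)\in\mathscr{H}$ for every $\varphi\in C_{l,Lip}(\mathbb R^n)$, where $C_{l,Lip}(\mathbb R^n)$ is the space of functions $\varphi$ with $|\varphi(x)-\varphi(y)|\le C(1+|x|^m+|y|^m)|x-y|$ for all $x,y\in\mathbb R^n$, for some $C>0$, $m\in\mathbb N$ depending on $\varphi$. Elements of $\mathscr{H}$ are the random variables in the space. A sub-linear expectation on $\mathscr{H}$ is a function $\widehat{\mathbb E}:\mathscr{H}\to[-\infty,\infty]$ such that for all $X,Y\in\mathscr{H}$: (a) $X\ge Y$ implies $\widehat{\mathbb E}[X]\ge\widehat{\mathbb E}[Y]$; (b) $\widehat{\mathbb E}[c]=c$ for constants $c$; (c) $\widehat{\mathbb E}[X+Y]\le\widehat{\mathbb E}[X]+\widehat{\mathbb E}[Y]$ whenever the right side is not of the form $+\infty-\infty$ or $-\infty+\infty$; (d) $\widehat{\mathbb E}[\lambda X]=\lambda\widehat{\mathbb E}[X]$ for $\lambda\ge 0$. The triple $(\Omega,\mathscr{H},\widehat{\mathbb E})$ is called a sub-linear expectation space. If $X\notin\mathscr{H}$, define $\widehat{\mathbb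 E}[X]=\inf\{\widehat{\mathbb E}[Y]:X\le Y,\ Y\in\mathscr{H}\}$ (and likewise for $\widetilde{\mathbb E}$). Capacity. $\mathbb V(A):=\inf\{\widehat{\mathbb E}[\xi]: I_A\le\xi,\ \xi\in\mathscr{H}\}$ for $A\in\mathcal F$, so $\mathbb V(A)=\widehat{\mathbb E}[I_A]$; $\widetilde{\mathbb V}$ is defined in the same way from $\widetilde{\mathbb E}$. $\mathbb V$ is countably sub-additive if $\mathbb V(\bigcup_{n=1}^\infty A_n)\le\sum_{n=1}^\infty\mathbb V(A_n)$ for all $A_n\in\mathcal F$. Independence. Let $C_{b,Lip}$ denote bounded Lipschitz functions. A random vector $Y=(Y_1,\dots,Y_n)$ ($Y_i\in\mathscr{H}$) is independent to $X=(X_1,\dots,X_m)$ ($X_i\in\mathscr{H}$) if $\widehat{\mathbb E}[\varphi(X,Y)]=\widehat{\mathbb E}\big[\widehat{\mathbb E}[\varphi(x,Y)]|_{x=X}\big]$ for all $\varphi\in C_{b,Lip}(\mathbb R^m\times\mathbb R^n)$. Random variables $\{X_n;n\ge1\}$ are independent if $X_{i+1}$ is independent to $(X_1,\dots,X_i)$ for each $i\ge1$. $C_b(\mathbb R)$ is the space of bounded continuous functions on $\mathbb R$. A random variable on the measurable space $(\Omega,\mathcal F)$ is a real $\mathcal F$-measurable function, not necessarily in $\mathscr{H}$. The event $\{\lim_n S_n\ne S\}$ is the complement of the event that $S_n(\omega)$ converges to $S(\omega)$. *)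

theory Defs
  imports "HOL-Analysis.Analysis"
begin

text \<open>
  Vectors of \<open>\<real>\<^sup>n\<close> are encoded as functions \<open>nat \<Rightarrow> real\<close> of which only the coordinates
  \<open>i < n\<close> count, with Euclidean norm \<open>L2_set x {..<n}\<close>. In the two function classes below
  the bound ranges over all \<open>x y :: nat \<Rightarrow> real\<close>; its right-hand side vanishes when \<open>x\<close> and
  \<open>y\<close> agree on \<open>{..<n}\<close>, so their members are exactly the functions that factor through
  \<open>\<real>\<^sup>n\<close> and satisfy the bound there.
\<close>

definition C_l_Lip :: "nat \<Rightarrow> ((nat \<Rightarrow> real) \<Rightarrow> real) set" where
  "C_l_Lip n = {\<phi>. \<exists>C>0. \<exists>m::nat. \<forall>x y.
     \<bar>\<phi> x - \<phi> y\<bar> \<le> C * (1 + L2_set x {..<n} ^ m + L2_set y {..<n} ^ m)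
                      * L2_set (\<lambda>i. x i - y i) {..<n}}"

definition C_b_Lip :: "nat \<Rightarrow> ((nat \<Rightarrow> real) \<Rightarrow> real) set" where
  "C_b_Lip n = {\<phi>. bounded (range \<phi>) \<and>
     (\<exists>C>0. \<forall>x y. \<bar>\<phi> x - \<phi> y\<bar> \<le> C * L2_set (\<lambda>i. x i - y i) {..<n})}"

text \<open>
  The measure component of \<open>M\<close> is irrelevant: only \<open>space M\<close> and \<open>sets M\<close> are used.
  Likewise only the values of \<open>E\<close> on \<open>H\<close> matter.
\<close>

locale sublinear_expectation_space =
  fixes M :: "'a measure"
    and H :: "('a \<Rightarrow> real) set"
    and E :: "('a \<Rightarrow> real) \<Rightarrow> ereal"
  assumes H_measurable: "H \<subseteq> borel_measurable M"
    and H_zero: "(\<lambda>_. 0) \<in> H"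
    and H_add: "\<And>X Y. X \<in> H \<Longrightarrow> Y \<in> H \<Longrightarrow> (\<lambda>\<omega>. X \<omega> + Y \<omega>) \<in> H"
    and H_scale: "\<And>c X. X \<in> H \<Longrightarrow> (\<lambda>\<omega>. c * X \<omega>) \<in> H"
    and H_closed: "\<And>n X \<phi>. \<phi> \<in> C_l_Lip n \<Longrightarrow> (\<And>i. i < n \<Longrightarrow> X i \<in> H) \<Longrightarrow>
                     (\<lambda>\<omega>. \<phi> (\<lambda>i. X i \<omega>)) \<in> H"
    and E_mono: "\<And>X Y. X \<in> H \<Longrightarrow> Y \<in> H \<Longrightarrow> (\<And>\<omega>. \<omega> \<in> space M \<Longrightarrow> Y \<omega> \<le> X \<omega>) \<Longrightarrow> E Y \<le> E X"
    and E_const: "\<And>c. E (\<lambda>_. c) = ereal c"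
    and E_subadd: "\<And>X Y. X \<in> H \<Longrightarrow> Y \<in> H \<Longrightarrow>
                     \<not> (E X = \<infinity> \<and> E Y = - \<infinity>) \<Longrightarrow> \<not> (E X = - \<infinity> \<and> E Y = \<infinity>) \<Longrightarrow>
                     E (\<lambda>\<omega>. X \<omega> + Y \<omega>) \<le> E X + E Y"
    and E_scale: "\<And>c X. X \<in> H \<Longrightarrow> 0 \<le> c \<Longrightarrow> E (\<lambda>\<omega>. c * X \<omega>) = ereal c * E X"

definition ext_expectation ::
    "'a measure \<Rightarrow> ('a \<Rightarrow> real) set \<Rightarrow> (('a \<Rightarrow> real) \<Rightarrow> ereal) \<Rightarrow> ('a \<Rightarrow> real) \<Rightarrow> ereal" where
  "ext_expectation M H E X =
     (if X \<in> H then E X else Inf {E Y | Y. Y \<in> H \<and> (\<forall>\<omega>\<in>space M. X \<omega> \<le> Y \<omega>)})"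

definition upper_capacity ::
    "'a measure \<Rightarrow> ('a \<Rightarrow> real) set \<Rightarrow> (('a \<Rightarrow> real) \<Rightarrow> ereal) \<Rightarrow> 'a set \<Rightarrow> ereal" where
  "upper_capacity M H E A =
     Inf {E \<xi> | \<xi>. \<xi> \<in> H \<and> (\<forall>\<omega>\<in>space M. indicator A \<omega> \<le> \<xi> \<omega>)}"

definition countably_sub_additive :: "'a measure \<Rightarrow> ('a set \<Rightarrow> ereal) \<Rightarrow> bool" where
  "countably_sub_additive M V \<longleftrightarrow>
     (\<forall>A :: nat \<Rightarrow> 'a set. range A \<subseteq> sets M \<longrightarrow> V (\<Union>n. A n) \<le> (\<Sum>n. V (A n)))"

definition tight ::
    "'a measure \<Rightarrow> ('a \<Rightarrow> real) set \<Rightarrow> (('a \<Rightarrow> real) \<Rightarrow> ereal) \<Rightarrow> ('a \<Rightarrow> real) \<Rightarrow> bool" where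
  "tight M H E S \<longleftrightarrow>
     ((\<lambda>x::real. upper_capacity M H E {\<omega> \<in> space M. \<bar>S \<omega>\<bar> > x}) \<longlongrightarrow> 0) at_top"

definition vec_append :: "nat \<Rightarrow> (nat \<Rightarrow> real) \<Rightarrow> (nat \<Rightarrow> real) \<Rightarrow> (nat \<Rightarrow> real)" where
  "vec_append m x y = (\<lambda>i. if i < m then x i else y (i - m))"

text \<open>
  \<open>independent_to M H E n Y m X\<close>: the vector \<open>(Y 0, \<dots>, Y (n - 1))\<close> is independent to
  \<open>(X 0, \<dots>, X (m - 1))\<close>, with \<open>\<real>\<^sup>m \<times> \<real>\<^sup>n\<close> identified with \<open>\<real>\<^bsup>m+n\<^esup>\<close>.
  For bounded \<open>\<phi>\<close> the inner expectation is finite, so \<open>real_of_ereal\<close> loses nothing.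
\<close>

definition independent_to ::
    "'a measure \<Rightarrow> ('a \<Rightarrow> real) set \<Rightarrow> (('a \<Rightarrow> real) \<Rightarrow> ereal) \<Rightarrow>
     nat \<Rightarrow> (nat \<Rightarrow> 'a \<Rightarrow> real) \<Rightarrow> nat \<Rightarrow> (nat \<Rightarrow> 'a \<Rightarrow> real) \<Rightarrow> bool" where
  "independent_to M H E n Y m X \<longleftrightarrow>
     (\<forall>i<n. Y i \<in> H) \<and> (\<forall>i<m. X i \<in> H) \<and>
     (\<forall>\<phi>\<in>C_b_Lip (m + n).
        ext_expectation M H E (\<lambda>\<omega>. \<phi> (vec_append m (\<lambda>i. X i \<omega>) (\<lambda>i. Y i \<omega>))) =
        ext_expectation M H E (\<lambda>\<omega>. real_of_ereal
          (ext_expectation M H E (\<lambda>\<omega>'. \<phi> (vec_append m (\<lambda>i. X i \<omega>) (\<lambda>i. Y i \<omega>'))))))"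

text \<open>Sequences are indexed from 1; \<open>X 0\<close> is never used.\<close>

definition independent_seq ::
    "'a measure \<Rightarrow> ('a \<Rightarrow> real) set \<Rightarrow> (('a \<Rightarrow> real) \<Rightarrow> ereal) \<Rightarrow> (nat \<Rightarrow> 'a \<Rightarrow> real) \<Rightarrow> bool" where
  "independent_seq M H E X \<longleftrightarrow>
     (\<forall>n\<ge>1. X n \<in> H) \<and>
     (\<forall>i\<ge>1. independent_to M H E 1 (\<lambda>_. X (i + 1)) i (\<lambda>j. X (j + 1)))"

definition partial_sum :: "(nat \<Rightarrow> 'a \<Rightarrow> real) \<Rightarrow> nat \<Rightarrow> 'a \<Rightarrow> real" where
  "partial_sum X n \<omega> = (\<Sum>k=1..n. X k \<omega>)"

definition converges_in_capacity ::
    "'a measure \<Rightarrow> ('a \<Rightarrow> real) set \<Rightarrow> (('a \<Rightarrow> real) \<Rightarrow> ereal) \<Rightarrow>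
     (nat \<Rightarrow> 'a \<Rightarrow> real) \<Rightarrow> ('a \<Rightarrow> real) \<Rightarrow> bool" where
  "converges_in_capacity M H E Z S \<longleftrightarrow>
     (\<forall>\<epsilon>>0. (\<lambda>n. upper_capacity M H E {\<omega> \<in> space M. \<bar>Z n \<omega> - S \<omega>\<bar> \<ge> \<epsilon>}) \<longlonglongrightarrow> 0)"

definition Cauchy_in_capacity ::
    "'a measure \<Rightarrow> ('a \<Rightarrow> real) set \<Rightarrow> (('a \<Rightarrow> real) \<Rightarrow> ereal) \<Rightarrow> (nat \<Rightarrow> 'a \<Rightarrow> real) \<Rightarrow> bool" where
  "Cauchy_in_capacity M H E Z \<longleftrightarrow>
     (\<forall>\<epsilon>>0. ((\<lambda>(n, m). upper_capacity M H E {\<omega> \<in> space M. \<bar>Z n \<omega> - Z m \<omega>\<bar> \<ge> \<epsilon>}) \<longlongrightarrow> 0)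
              (sequentially \<times>\<^sub>F sequentially))"

end

theory Submission imports Defs begin

text \<open>
  The extended expectation is finite and sub-linear on all bounded functions on \<open>\<Omega>\<close>, whether or
  not they lie in \<open>\<H>\<close>, and the capacity of an event is its value at the indicator. So the
  arguments below use only a monotone sub-linear functional \<open>F\<close> on bounded functions; test
  functions have to be Lipschitz only where independence or convergence of the laws is applied.

  Convergence in capacity implies convergence of the laws as in the classical case, because a
  bounded continuous function is uniformly continuous where a tight limit mostly lives.

  The main point is that convergence of the laws makes the partial sums Cauchy. Characteristic
  functions are not available for sub-linear expectations; a random walk replaces them.
  For large \<open>n \<le> m\<close>, an independent step \<open>Y\<close> with the law of \<open>S\<^sub>m - S\<^sub>n\<close> hardly changes the
  law of \<open>S\<^sub>n\<close>. Since the unit ball of bounded Lipschitz functions is totally bounded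
  up to tails (\<open>finite_net_bounded_lipschitz\<close>), this holds uniformly in the test function
  (\<open>laws_uniformly_Cauchy\<close>), and therefore for a prescribed number of successive independent
  steps, so that the walk with step \<open>Y\<close> started at \<open>S\<^sub>n\<close> stays tight for that long. But if
  \<open>Y \<ge> e\<close> has capacity at least \<open>\<delta>\<close>, the walk
  is made to leave any given interval within a number of steps that depends only on the interval,
  \<open>e\<close> and \<open>\<delta>\<close>, and is unlikely to be back later (\<open>walk_escape\<close>, \<open>walk_not_tight\<close>). Hence \<open>Y \<ge> e\<close> has small
  capacity, and so has \<open>Y \<le> - e\<close> by reflection.

  For convergence outside a set of capacity zero, Ottaviani's inequality (\<open>ottaviani\<close>) turns the
  Cauchy property into smallness of the maximal oscillation over finite blocks of indices.
  Countable sub-additivity then yields a Borel--Cantelli argument along a sparse sequence of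
  blocks (\<open>small_oscillation_convergence\<close>).
\<close>

section \<open>Sub-linear functionals on bounded functions\<close>

definition bounded_fun :: "'a set \<Rightarrow> ('a \<Rightarrow> real) \<Rightarrow> bool" where
  "bounded_fun \<Omega> X \<longleftrightarrow> (\<exists>B. \<forall>\<omega>\<in>\<Omega>. \<bar>X \<omega>\<bar> \<le> B)"

lemma bounded_funI: "(\<And>\<omega>. \<omega> \<in> \<Omega> \<Longrightarrow> \<bar>X \<omega>\<bar> \<le> B) \<Longrightarrow> bounded_fun \<Omega> X"
  unfolding bounded_fun_def by blast

lemma bounded_fun_const: "bounded_fun \<Omega> (\<lambda>_. c)"
  by (rule bounded_funI[of _ _ "\<bar>c\<bar>"]) simp

lemma bounded_fun_indicator: "bounded_fun \<Omega> (\<lambda>\<omega>. indicator A (Z \<omega>))"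
  by (rule bounded_funI[of _ _ 1]) (simp add: indicator_def)

lemma bounded_fun_indicator_set: "bounded_fun \<Omega> (indicator A)"
  by (rule bounded_fun_indicator[of _ _ "\<lambda>\<omega>. \<omega>"])

lemma bounded_fun_add:
  assumes "bounded_fun \<Omega> X" "bounded_fun \<Omega> Y"
  shows "bounded_fun \<Omega> (\<lambda>\<omega>. X \<omega> + Y \<omega>)"
proof -
  obtain B C where "\<forall>\<omega>\<in>\<Omega>. \<bar>X \<omega>\<bar> \<le> B" "\<forall>\<omega>\<in>\<Omega>. \<bar>Y \<omega>\<bar> \<le> C"
    using assms unfolding bounded_fun_def by blast
  then show ?thesis by (intro bounded_funI[of _ _ "B + C"]) fastforce
qed

lemma bounded_fun_mult:
  assumes "bounded_fun \<Omega> X" "bounded_fun \<Omega> Y"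
  shows "bounded_fun \<Omega> (\<lambda>\<omega>. X \<omega> * Y \<omega>)"
proof -
  obtain B C where BC: "\<forall>\<omega>\<in>\<Omega>. \<bar>X \<omega>\<bar> \<le> B" "\<forall>\<omega>\<in>\<Omega>. \<bar>Y \<omega>\<bar> \<le> C"
    using assms unfolding bounded_fun_def by blast
  show ?thesis
  proof (rule bounded_funI)
    fix \<omega> assume "\<omega> \<in> \<Omega>"
    then show "\<bar>X \<omega> * Y \<omega>\<bar> \<le> \<bar>B\<bar> * \<bar>C\<bar>"
      unfolding abs_mult using BC by (intro mult_mono) (auto intro: order_trans[OF _ abs_ge_self])
  qed
qed

lemma bounded_fun_compose: "bounded_fun UNIV \<phi> \<Longrightarrow> bounded_fun \<Omega> (\<lambda>\<omega>. \<phi> (Z \<omega>))"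
  unfolding bounded_fun_def by blast

lemmas bounded_fun_rules =
  bounded_fun_const bounded_fun_indicator bounded_fun_add bounded_fun_mult

locale sublinear_functional =
  fixes \<Omega> :: "'a set" and F :: "('a \<Rightarrow> real) \<Rightarrow> real"
  assumes const: "F (\<lambda>_. c) = c"
    and mono: "bounded_fun \<Omega> X \<Longrightarrow> bounded_fun \<Omega> Y \<Longrightarrow>
                 (\<And>\<omega>. \<omega> \<in> \<Omega> \<Longrightarrow> X \<omega> \<le> Y \<omega>) \<Longrightarrow> F X \<le> F Y"
    and subadd: "bounded_fun \<Omega> X \<Longrightarrow> bounded_fun \<Omega> Y \<Longrightarrow>
                   F (\<lambda>\<omega>. X \<omega> + Y \<omega>) \<le> F X + F Y"
    and scale: "bounded_fun \<Omega> X \<Longrightarrow> 0 \<le> c \<Longrightarrow> F (\<lambda>\<omega>. c * X \<omega>) = c * F X"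
begin

lemma cong:
  assumes "bounded_fun \<Omega> X" "\<And>\<omega>. \<omega> \<in> \<Omega> \<Longrightarrow> X \<omega> = Y \<omega>"
  shows "F X = F Y"
proof -
  have "bounded_fun \<Omega> Y" using assms unfolding bounded_fun_def by simp
  then show ?thesis using assms by (intro antisym mono) auto
qed

lemma le_const:
  assumes "bounded_fun \<Omega> X" "\<And>\<omega>. \<omega> \<in> \<Omega> \<Longrightarrow> X \<omega> \<le> c"
  shows "F X \<le> c"
  using mono[OF assms(1) bounded_fun_const[of \<Omega> c]] assms(2) const by simp

lemma ge_const:
  assumes "bounded_fun \<Omega> X" "\<And>\<omega>. \<omega> \<in> \<Omega> \<Longrightarrow> c \<le> X \<omega>"
  shows "c \<le> F X"
  using mono[OF bounded_fun_const[of \<Omega> c] assms(1)] assms(2) const by simp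

lemma abs_le:
  assumes "\<And>\<omega>. \<omega> \<in> \<Omega> \<Longrightarrow> \<bar>X \<omega>\<bar> \<le> B"
  shows "\<bar>F X\<bar> \<le> B"
proof -
  have b: "bounded_fun \<Omega> X" using assms by (rule bounded_funI)
  have X: "X \<omega> \<le> B" "- B \<le> X \<omega>" if "\<omega> \<in> \<Omega>" for \<omega> using assms[OF that] by auto
  show ?thesis using le_const[OF b X(1)] ge_const[OF b X(2)] by linarith
qed

lemma add_le:
  assumes "bounded_fun \<Omega> X" "bounded_fun \<Omega> Y" "bounded_fun \<Omega> Z"
    and "\<And>\<omega>. \<omega> \<in> \<Omega> \<Longrightarrow> X \<omega> \<le> Y \<omega> + Z \<omega>"
  shows "F X \<le> F Y + F Z"
  using mono[OF assms(1) bounded_fun_add[OF assms(2,3)] assms(4)] subadd[OF assms(2,3)]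
  by linarith

lemma add_const:
  assumes "bounded_fun \<Omega> X"
  shows "F (\<lambda>\<omega>. X \<omega> + c) = F X + c"
proof (rule antisym)
  show "F (\<lambda>\<omega>. X \<omega> + c) \<le> F X + c"
    using subadd[OF assms bounded_fun_const[of _ c]] const by simp
  have "F X \<le> F (\<lambda>\<omega>. X \<omega> + c) + F (\<lambda>_. - c)"
    using assms by (intro add_le bounded_fun_rules) auto
  then show "F X + c \<le> F (\<lambda>\<omega>. X \<omega> + c)" using const by simp
qed

lemma le_add_const:
  assumes "bounded_fun \<Omega> X" "bounded_fun \<Omega> Y" "\<And>\<omega>. \<omega> \<in> \<Omega> \<Longrightarrow> X \<omega> \<le> Y \<omega> + c"
  shows "F X \<le> F Y + c"
  using add_le[OF assms(1,2) bounded_fun_const[of _ c] assms(3)] const by simp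

lemma abs_diff_le:
  assumes "bounded_fun \<Omega> X" "bounded_fun \<Omega> Y" "\<And>\<omega>. \<omega> \<in> \<Omega> \<Longrightarrow> \<bar>X \<omega> - Y \<omega>\<bar> \<le> c"
  shows "\<bar>F X - F Y\<bar> \<le> c"
proof -
  have "F X \<le> F Y + c"
    by (rule le_add_const[OF assms(1,2)]) (use assms(3) in \<open>auto simp: abs_le_iff algebra_simps\<close>)
  moreover have "F Y \<le> F X + c"
    by (rule le_add_const[OF assms(2,1)]) (use assms(3) in \<open>auto simp: abs_le_iff algebra_simps\<close>)
  ultimately show ?thesis by linarith
qed

lemma law: "sublinear_functional UNIV (\<lambda>\<phi>. F (\<lambda>\<omega>. \<phi> (Z \<omega>)))"
proof
  fix X Y :: "'b \<Rightarrow> real" and c :: real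
  assume X: "bounded_fun UNIV X"
  note X' = bounded_fun_compose[OF X]
  show "0 \<le> c \<Longrightarrow> F (\<lambda>\<omega>. c * X (Z \<omega>)) = c * F (\<lambda>\<omega>. X (Z \<omega>))"
    by (rule scale[OF X'])
  assume Y: "bounded_fun UNIV Y"
  note Y' = bounded_fun_compose[OF Y]
  show "F (\<lambda>\<omega>. X (Z \<omega>) + Y (Z \<omega>)) \<le> F (\<lambda>\<omega>. X (Z \<omega>)) + F (\<lambda>\<omega>. Y (Z \<omega>))"
    by (rule subadd[OF X' Y'])
  assume "\<And>z. z \<in> UNIV \<Longrightarrow> X z \<le> Y z"
  then show "F (\<lambda>\<omega>. X (Z \<omega>)) \<le> F (\<lambda>\<omega>. Y (Z \<omega>))"
    by (intro mono X' Y') auto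
qed (rule const)

end

section \<open>Bounded Lipschitz functions\<close>

definition bounded_lipschitz :: "(real \<Rightarrow> real) \<Rightarrow> bool" where
  "bounded_lipschitz \<phi> \<longleftrightarrow> bounded_fun UNIV \<phi> \<and> (\<exists>C. C-lipschitz_on UNIV \<phi>)"

lemma bounded_lipschitz_bounded_fun: "bounded_lipschitz \<phi> \<Longrightarrow> bounded_fun \<Omega> (\<lambda>\<omega>. \<phi> (Z \<omega>))"
  unfolding bounded_lipschitz_def by (blast intro: bounded_fun_compose)

lemma bcontfun_bounded_fun:
  fixes \<phi> :: "real \<Rightarrow> real"
  shows "\<phi> \<in> bcontfun \<Longrightarrow> bounded_fun \<Omega> (\<lambda>\<omega>. \<phi> (Z \<omega>))"
  unfolding bcontfun_def bounded_iff by (auto intro: bounded_funI)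

lemma bounded_lipschitz_bcontfun: "bounded_lipschitz \<phi> \<Longrightarrow> \<phi> \<in> bcontfun"
  unfolding bounded_lipschitz_def bounded_fun_def bcontfun_def bounded_iff
  by (auto dest: lipschitz_on_continuous_on)

lemma lipschitz_on_UNIV_real_iff:
  fixes \<phi> :: "real \<Rightarrow> real"
  shows "C-lipschitz_on UNIV \<phi> \<longleftrightarrow> 0 \<le> C \<and> (\<forall>x y. \<bar>\<phi> x - \<phi> y\<bar> \<le> C * \<bar>x - y\<bar>)"
  by (auto simp: lipschitz_on_def dist_real_def)

text \<open>
  A continuous stand-in for the indicator of \<open>{x. \<bar>x\<bar> > K}\<close>, lying between the indicators of
  \<open>{x. \<bar>x\<bar> \<ge> K + 1}\<close> and of \<open>{x. \<bar>x\<bar> > K}\<close>.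
\<close>

definition tail_cutoff :: "real \<Rightarrow> real \<Rightarrow> real" where
  "tail_cutoff K x = min 1 (max 0 (\<bar>x\<bar> - K))"

lemma tail_cutoff_bounds: "0 \<le> tail_cutoff K x" "tail_cutoff K x \<le> 1" "\<bar>tail_cutoff K x\<bar> \<le> 1"
  by (auto simp: tail_cutoff_def)

lemma tail_cutoff_lipschitz: "1-lipschitz_on UNIV (tail_cutoff K)"
  unfolding lipschitz_on_UNIV_real_iff tail_cutoff_def by (auto simp: abs_if min_def max_def)

lemma bounded_fun_tail_cutoff: "bounded_fun \<Omega> (\<lambda>\<omega>. tail_cutoff K (Z \<omega>))"
  by (rule bounded_funI[of _ _ 1]) (rule tail_cutoff_bounds)

lemma bounded_lipschitz_tail_cutoff: "bounded_lipschitz (tail_cutoff K)"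
  unfolding bounded_lipschitz_def
  using tail_cutoff_lipschitz bounded_fun_tail_cutoff[where Z = "\<lambda>x. x"] by auto

text \<open>
  Total boundedness of the unit ball of bounded Lipschitz functions, with respect to uniform
  distance on a compact interval. Two functions whose values at the points of a grid of mesh
  \<open>\<gamma>\<close> have the same integer part after division by \<open>\<gamma>\<close> are \<open>3 * \<gamma>\<close>-close, and there are
  finitely many such lists of integer parts; the net has one representative for each of them.
\<close>

lemma finite_net_bounded_lipschitz:
  fixes K \<gamma> :: real
  assumes "\<gamma> > 0"
  defines "L \<equiv> {\<phi> :: real \<Rightarrow> real. (\<forall>x. \<bar>\<phi> x\<bar> \<le> 1) \<and> 1-lipschitz_on UNIV \<phi>}"
  shows "\<exists>\<Psi>\<subseteq>L. finite \<Psi> \<and> (\<forall>\<phi>\<in>L. \<exists>\<psi>\<in>\<Psi>. \<forall>x. \<bar>x\<bar> \<le> K \<longrightarrow> \<bar>\<phi> x - \<psi> x\<bar> \<le> 3 * \<gamma>)"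
proof -
  define G where "G = {\<lfloor>- K / \<gamma>\<rfloor>..\<lfloor>K / \<gamma>\<rfloor>}"
  define D where "D = {\<lfloor>- 1 / \<gamma>\<rfloor>..\<lfloor>1 / \<gamma>\<rfloor>}"
  define code where
    "code = (\<lambda>\<phi> :: real \<Rightarrow> real. restrict (\<lambda>k. \<lfloor>\<phi> (of_int k * \<gamma>) / \<gamma>\<rfloor>) G)"
  define \<Psi> where "\<Psi> = inv_into L code ` (code ` L)"
  have "code ` L \<subseteq> G \<rightarrow>\<^sub>E D"
  proof (rule image_subsetI)
    fix \<phi> assume \<phi>: "\<phi> \<in> L"
    have "\<lfloor>\<phi> x / \<gamma>\<rfloor> \<in> D" for x
    proof -
      have "\<bar>\<phi> x\<bar> \<le> 1" using \<phi> by (simp add: L_def)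
      then have "- 1 / \<gamma> \<le> \<phi> x / \<gamma>" "\<phi> x / \<gamma> \<le> 1 / \<gamma>"
        using \<open>\<gamma> > 0\<close> by (intro divide_right_mono; simp add: abs_le_iff)+
      then show ?thesis unfolding D_def by (auto intro: floor_mono)
    qed
    then show "code \<phi> \<in> G \<rightarrow>\<^sub>E D" unfolding code_def by auto
  qed
  moreover have "finite (G \<rightarrow>\<^sub>E D)" by (rule finite_PiE) (auto simp: G_def D_def)
  ultimately have "finite (code ` L)" by (rule finite_subset)
  then have "finite \<Psi>" by (simp add: \<Psi>_def)
  moreover have "\<Psi> \<subseteq> L" unfolding \<Psi>_def by (auto intro: inv_into_into)
  moreover have "\<exists>\<psi>\<in>\<Psi>. \<forall>x. \<bar>x\<bar> \<le> K \<longrightarrow> \<bar>\<phi> x - \<psi> x\<bar> \<le> 3 * \<gamma>" if \<phi>: "\<phi> \<in> L" for \<phi>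
  proof
    define \<psi> where "\<psi> = inv_into L code (code \<phi>)"
    show "inv_into L code (code \<phi>) \<in> \<Psi>" using \<phi> by (auto simp: \<Psi>_def)
    have \<psi>: "\<psi> \<in> L" "code \<psi> = code \<phi>"
      using \<phi> unfolding \<psi>_def by (simp_all add: inv_into_into f_inv_into_f)
    show "\<forall>x. \<bar>x\<bar> \<le> K \<longrightarrow> \<bar>\<phi> x - inv_into L code (code \<phi>) x\<bar> \<le> 3 * \<gamma>"
      unfolding \<psi>_def[symmetric]
    proof (intro allI impI)
      fix x assume x: "\<bar>x\<bar> \<le> K"
      define k where "k = \<lfloor>x / \<gamma>\<rfloor>"
      define y where "y = of_int k * \<gamma>"
      have "- K / \<gamma> \<le> x / \<gamma>" "x / \<gamma> \<le> K / \<gamma>"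
        using x \<open>\<gamma> > 0\<close> by (intro divide_right_mono; simp add: abs_le_iff)+
      then have "k \<in> G" unfolding k_def G_def by (auto intro: floor_mono)
      then have eq: "\<lfloor>\<phi> y / \<gamma>\<rfloor> = \<lfloor>\<psi> y / \<gamma>\<rfloor>"
        using fun_cong[OF \<psi>(2), of k] by (simp add: code_def y_def)
      have close: "\<bar>u - v\<bar> \<le> \<gamma>" if "\<lfloor>u / \<gamma>\<rfloor> = \<lfloor>v / \<gamma>\<rfloor>" for u v
      proof -
        have "\<bar>u / \<gamma> - v / \<gamma>\<bar> \<le> 1" using that by linarith
        then have "\<bar>(u - v) / \<gamma>\<bar> \<le> 1" by (simp add: diff_divide_distrib)
        then show ?thesis using \<open>\<gamma> > 0\<close> by (simp add: abs_divide)
      qed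
      have "\<bar>x - y\<bar> \<le> \<gamma>" by (rule close) (use \<open>\<gamma> > 0\<close> in \<open>simp add: y_def k_def\<close>)
      then have "\<bar>\<phi> x - \<phi> y\<bar> \<le> \<gamma>" "\<bar>\<psi> x - \<psi> y\<bar> \<le> \<gamma>"
        using \<phi> \<psi>(1) unfolding L_def lipschitz_on_UNIV_real_iff mult_1 mem_Collect_eq
        by (blast intro: order_trans)+
      then show "\<bar>\<phi> x - \<psi> x\<bar> \<le> 3 * \<gamma>" using close[OF eq] by linarith
    qed
  qed
  ultimately show ?thesis by blast
qed

section \<open>Random walks with a sub-linear step law\<close>

text \<open>One step of the walk whose increments have law \<open>F\<close>, acting on functions of its position.\<close>

definition walk_step :: "((real \<Rightarrow> real) \<Rightarrow> real) \<Rightarrow> (real \<Rightarrow> real) \<Rightarrow> real \<Rightarrow> real" where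
  "walk_step F \<phi> s = F (\<lambda>y. \<phi> (s + y))"

context
  fixes F :: "(real \<Rightarrow> real) \<Rightarrow> real"
  assumes F: "sublinear_functional UNIV F"
begin

interpretation F: sublinear_functional UNIV F by (rule F)

lemma walk_iter_abs_le:
  assumes "\<And>x. \<bar>\<phi> x\<bar> \<le> B"
  shows "\<bar>(walk_step F ^^ j) \<phi> s\<bar> \<le> B"
proof (induction j arbitrary: s)
  case (Suc j)
  then show ?case by (auto simp: walk_step_def intro: F.abs_le)
qed (use assms in simp)

lemma walk_iter_bounded_fun: "bounded_fun UNIV \<phi> \<Longrightarrow> bounded_fun UNIV ((walk_step F ^^ j) \<phi>)"
  unfolding bounded_fun_def using walk_iter_abs_le by blast

text \<open>Taking \<open>j\<close> steps from a fixed position is again a sub-linear functional.\<close>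

lemma walk_iter_sublinear: "sublinear_functional UNIV (\<lambda>\<phi>. (walk_step F ^^ j) \<phi> s)"
proof (induction j arbitrary: s)
  case 0
  show ?case by standard auto
next
  case (Suc j)
  let ?T = "\<lambda>\<phi>. (walk_step F ^^ j) \<phi>"
  have T: "sublinear_functional UNIV (\<lambda>\<phi>. ?T \<phi> s)" for s by (rule Suc)
  have b: "bounded_fun UNIV (\<lambda>y. ?T \<phi> (s + y))" if "bounded_fun UNIV \<phi>" for \<phi>
    by (rule bounded_fun_compose[OF walk_iter_bounded_fun[OF that]])
  show ?case
  proof
    show "(walk_step F ^^ Suc j) (\<lambda>_. c) s = c" for c
      by (simp add: walk_step_def sublinear_functional.const[OF T] F.const)
  next
    fix X Y :: "real \<Rightarrow> real"
    assume XY: "bounded_fun UNIV X" "bounded_fun UNIV Y" "\<And>\<omega>. \<omega> \<in> UNIV \<Longrightarrow> X \<omega> \<le> Y \<omega>"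
    show "(walk_step F ^^ Suc j) X s \<le> (walk_step F ^^ Suc j) Y s"
      unfolding funpow.simps o_apply walk_step_def[of F "_ _"]
      by (intro F.mono b XY sublinear_functional.mono[OF T]) (use XY in auto)
  next
    fix X Y :: "real \<Rightarrow> real"
    assume XY: "bounded_fun UNIV X" "bounded_fun UNIV Y"
    show "(walk_step F ^^ Suc j) (\<lambda>\<omega>. X \<omega> + Y \<omega>) s
        \<le> (walk_step F ^^ Suc j) X s + (walk_step F ^^ Suc j) Y s"
      unfolding funpow.simps o_apply walk_step_def[of F "_ _"]
      by (intro F.add_le b XY bounded_fun_add sublinear_functional.subadd[OF T])
  next
    fix X :: "real \<Rightarrow> real" and c :: real
    assume X: "bounded_fun UNIV X" "0 \<le> c"
    show "(walk_step F ^^ Suc j) (\<lambda>\<omega>. c * X \<omega>) s = c * (walk_step F ^^ Suc j) X s"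
      unfolding funpow.simps o_apply walk_step_def[of F "_ _"] sublinear_functional.scale[OF T X]
      by (intro F.scale b X)
  qed
qed

lemma walk_iter_shift: "(walk_step F ^^ j) (\<lambda>x. \<phi> (s + x)) t = (walk_step F ^^ j) \<phi> (s + t)"
  by (induction j arbitrary: t) (simp_all add: walk_step_def add.assoc)

lemma walk_iter_lipschitz:
  assumes "bounded_fun UNIV \<phi>" "C-lipschitz_on UNIV \<phi>"
  shows "C-lipschitz_on UNIV ((walk_step F ^^ j) \<phi>)"
proof (induction j)
  case (Suc j)
  show ?case
    unfolding lipschitz_on_UNIV_real_iff
  proof (intro conjI allI)
    fix x y
    show "\<bar>(walk_step F ^^ Suc j) \<phi> x - (walk_step F ^^ Suc j) \<phi> y\<bar> \<le> C * \<bar>x - y\<bar>"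
      unfolding funpow.simps o_apply walk_step_def[of F "_ _"]
    proof (rule F.abs_diff_le)
      fix z
      show "\<bar>(walk_step F ^^ j) \<phi> (x + z) - (walk_step F ^^ j) \<phi> (y + z)\<bar> \<le> C * \<bar>x - y\<bar>"
        using Suc unfolding lipschitz_on_UNIV_real_iff
        by (metis add_diff_cancel_right)
    qed (rule bounded_fun_compose[OF walk_iter_bounded_fun[OF assms(1)]])+
  qed (use assms in \<open>simp add: lipschitz_on_UNIV_real_iff\<close>)
qed (use assms in simp)

lemma bounded_lipschitz_walk_step:
  assumes "bounded_lipschitz \<phi>"
  shows "bounded_lipschitz (walk_step F \<phi>)"
  using assms walk_iter_bounded_fun[of \<phi> 1] walk_iter_lipschitz[of \<phi> _ 1]
  unfolding bounded_lipschitz_def by auto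

text \<open>
  If a step of length at least \<open>e\<close> to the right has capacity at least \<open>\<delta>\<close>, then from any point
  of \<open>{- R..R}\<close> the capacity of leaving this interval within \<open>N \<ge> 2 * R / e\<close> steps is at least
  \<open>\<delta> ^ N\<close>: it suffices to make \<open>N\<close> such steps in a row. So if \<open>\<psi>\<close> is at least \<open>a\<close> everywhere,
  and its iterates are at least \<open>q \<ge> a\<close> outside the interval, then after \<open>N\<close> steps the gap
  \<open>q - a\<close> has shrunk by the factor \<open>1 - \<delta> ^ N\<close>.
\<close>

lemma walk_escape_block:
  fixes \<delta> e R a q :: real
  assumes \<psi>: "bounded_fun UNIV \<psi>" "\<And>x. a \<le> \<psi> x"
    and "a \<le> q" "0 \<le> \<delta>" "\<delta> \<le> 1" "\<delta> \<le> F (indicator {e..})"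
    and far: "\<And>i s. i \<le> N \<Longrightarrow> R \<le> \<bar>s\<bar> \<Longrightarrow> q \<le> (walk_step F ^^ i) \<psi> s"
    and N: "2 * R \<le> real N * e"
  shows "a + (q - a) * \<delta> ^ N \<le> (walk_step F ^^ N) \<psi> s"
proof -
  have ge_a: "a \<le> (walk_step F ^^ i) \<psi> s" for i s
    by (rule sublinear_functional.ge_const[OF walk_iter_sublinear \<psi>(1)]) (rule \<psi>)
  have *: "a + (q - a) * \<delta> ^ i \<le> (walk_step F ^^ i) \<psi> s"
    if "i \<le> N" "R - real i * e \<le> s \<or> R \<le> \<bar>s\<bar>" for i s
    using that
  proof (induction i arbitrary: s)
    case 0
    then have "R \<le> \<bar>s\<bar>" by auto
    then show ?case using far[of 0 s] by simp
  next
    case (Suc i)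
    show ?case
    proof (cases "R \<le> \<bar>s\<bar>")
      case True
      have "(q - a) * \<delta> ^ Suc i \<le> (q - a) * 1"
        using assms by (intro mult_left_mono power_le_one) auto
      then have "a + (q - a) * \<delta> ^ Suc i \<le> q" by simp
      then show ?thesis using far[OF Suc.prems(1) True] by (rule order_trans)
    next
      case False
      then have s: "R - real (Suc i) * e \<le> s" using Suc.prems by blast
      let ?c = "(q - a) * \<delta> ^ i"
      have c: "0 \<le> ?c" using assms by simp
      have "a + ?c * \<delta> \<le> ?c * F (indicator {e..}) + a"
        using mult_left_mono[OF \<open>\<delta> \<le> F (indicator {e..})\<close> c] by linarith
      also have "\<dots> = F (\<lambda>y. ?c * indicator {e..} y + a)"
        using c by (simp add: F.scale F.add_const bounded_fun_rules)
      also have "\<dots> \<le> F (\<lambda>y. (walk_step F ^^ i) \<psi> (s + y))"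
      proof (rule F.mono)
        fix y
        show "?c * indicator {e..} y + a \<le> (walk_step F ^^ i) \<psi> (s + y)"
        proof (cases "e \<le> y")
          case True
          then have "R - real i * e \<le> s + y" using s by (simp add: algebra_simps)
          then show ?thesis using Suc.IH[of "s + y"] Suc.prems True by simp
        qed (use ge_a in simp)
      qed (intro bounded_fun_rules bounded_fun_compose[OF walk_iter_bounded_fun[OF \<psi>(1)]])+
      finally show ?thesis by (simp add: walk_step_def[of F "_ _"] mult_ac)
    qed
  qed
  have "R - real N * e \<le> s \<or> R \<le> \<bar>s\<bar>" using N by linarith
  then show ?thesis by (rule *[OF order_refl])
qed

lemma walk_escape:
  fixes \<delta> e R q :: real
  assumes \<psi>: "bounded_fun UNIV \<psi>" "\<And>x. 0 \<le> \<psi> x"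
    and "0 \<le> q" "0 \<le> \<delta>" "\<delta> \<le> 1" "\<delta> \<le> F (indicator {e..})"
    and far: "\<And>i s. i \<le> k * N \<Longrightarrow> R \<le> \<bar>s\<bar> \<Longrightarrow> q \<le> (walk_step F ^^ i) \<psi> s"
    and N: "2 * R \<le> real N * e"
  shows "q * (1 - (1 - \<delta> ^ N) ^ k) \<le> (walk_step F ^^ (k * N)) \<psi> s"
  using far
proof (induction k arbitrary: s)
  case 0
  then show ?case using \<psi> by simp
next
  case (Suc k)
  define b where "b = (1 - \<delta> ^ N) ^ k"
  define a where "a = q * (1 - b)"
  define \<psi>' where "\<psi>' = (walk_step F ^^ (k * N)) \<psi>"
  have "0 \<le> b" unfolding b_def using assms by (simp add: power_le_one)
  have iter: "(walk_step F ^^ i) \<psi>' = (walk_step F ^^ (i + k * N)) \<psi>" for i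
    by (simp add: \<psi>'_def funpow_add)
  have "a + (q - a) * \<delta> ^ N \<le> (walk_step F ^^ N) \<psi>' s"
  proof (rule walk_escape_block)
    show "bounded_fun UNIV \<psi>'" unfolding \<psi>'_def by (rule walk_iter_bounded_fun[OF \<psi>(1)])
    show "a \<le> \<psi>' x" for x
      unfolding a_def \<psi>'_def b_def by (rule Suc.IH) (use Suc.prems in auto)
    show "a \<le> q" unfolding a_def using \<open>0 \<le> b\<close> \<open>0 \<le> q\<close> by (simp add: algebra_simps)
    show "q \<le> (walk_step F ^^ i) \<psi>' s" if "i \<le> N" "R \<le> \<bar>s\<bar>" for i s
      unfolding iter by (rule Suc.prems) (use that in auto)
  qed (use assms in auto)
  moreover have "a + (q - a) * \<delta> ^ N = q * (1 - (1 - \<delta> ^ N) ^ Suc k)"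
    by (simp add: a_def b_def algebra_simps)
  moreover have "N + k * N = Suc k * N" by simp
  ultimately show ?case by (simp only: iter)
qed

text \<open>
  If \<open>A\<close> is tight and steps of at least \<open>e\<close> have capacity at least \<open>\<delta>\<close>, the walk started from \<open>A\<close>
  cannot stay tight for many steps. If it did, its total displacement would be tight as well, so from outside \<open>{- R..R}\<close>, with \<open>R = 3 * K + 1\<close>, it
  would be unlikely to be back in \<open>{- K..K}\<close> at any later time. But it does leave
  \<open>{- R..R}\<close> sooner or later, hence would be far out at the end.
\<close>

lemma walk_not_tight:
  assumes A: "sublinear_functional UNIV A"
    and tight: "\<And>j. j \<le> k * N \<Longrightarrow> A ((walk_step F ^^ j) (tail_cutoff K)) \<le> 1 / 8"
    and "0 \<le> K" "0 \<le> \<delta>" "\<delta> \<le> 1"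
    and N: "2 * (3 * K + 1) \<le> real N * e"
    and k: "(1 - \<delta> ^ N) ^ k \<le> 1 / 2"
  shows "F (indicator {e..}) < \<delta>"
proof (rule ccontr)
  assume "\<not> F (indicator {e..}) < \<delta>"
  then have \<delta>: "\<delta> \<le> F (indicator {e..})" by simp
  interpret A: sublinear_functional UNIV A by (rule A)
  let ?T = "\<lambda>j. (walk_step F ^^ j)"
  have b: "bounded_fun UNIV (?T j (tail_cutoff L))" for j L
    by (rule walk_iter_bounded_fun[OF bounded_fun_tail_cutoff])
  have displacement: "?T j (tail_cutoff (2 * K)) 0 \<le> 1 / 4" if "j \<le> k * N" for j
  proof -
    have "?T j (tail_cutoff (2 * K)) 0 \<le> ?T j (tail_cutoff K) s + tail_cutoff K s" for s
    proof -
      have "tail_cutoff (2 * K) x \<le> tail_cutoff K (s + x) + tail_cutoff K s" for x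
        using abs_triangle_ineq[of "s + x" "- s"] by (auto simp: tail_cutoff_def min_def max_def)
      then have "?T j (tail_cutoff (2 * K)) 0
          \<le> ?T j (\<lambda>x. tail_cutoff K (s + x)) 0 + tail_cutoff K s"
        by (intro sublinear_functional.le_add_const[OF walk_iter_sublinear]
            bounded_fun_tail_cutoff)
      then show ?thesis by (simp add: walk_iter_shift)
    qed
    then have "A (\<lambda>_. ?T j (tail_cutoff (2 * K)) 0) \<le> A (?T j (tail_cutoff K)) + A (tail_cutoff K)"
      by (intro A.add_le b bounded_fun_const bounded_fun_tail_cutoff)
    then show ?thesis using tight[OF that] tight[of 0] by (simp add: A.const)
  qed
  have far: "3 / 4 \<le> ?T j (tail_cutoff K) s" if "j \<le> k * N" "3 * K + 1 \<le> \<bar>s\<bar>" for j s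
  proof -
    have "1 \<le> tail_cutoff K (s + x) + tail_cutoff (2 * K) x" for x
      using abs_triangle_ineq[of "s + x" "- x"] that(2) by (auto simp: tail_cutoff_def min_def max_def)
    then have "?T j (\<lambda>_. 1) 0 \<le> ?T j (\<lambda>x. tail_cutoff K (s + x)) 0 + ?T j (tail_cutoff (2 * K)) 0"
      by (intro sublinear_functional.add_le[OF walk_iter_sublinear]
          bounded_fun_const bounded_fun_tail_cutoff)
    then show ?thesis
      using displacement[OF that(1)]
      by (simp add: walk_iter_shift sublinear_functional.const[OF walk_iter_sublinear])
  qed
  have "3 / 4 * (1 - (1 - \<delta> ^ N) ^ k) \<le> ?T (k * N) (tail_cutoff K) s" for s
    by (rule walk_escape[OF bounded_fun_tail_cutoff _ _ _ _ \<delta> far N])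
      (use assms tail_cutoff_bounds in auto)
  then have "3 / 4 * (1 - (1 - \<delta> ^ N) ^ k) \<le> A (?T (k * N) (tail_cutoff K))"
    by (rule A.ge_const[OF b])
  then show False using tight[of "k * N"] k by simp
qed

end

section \<open>Cauchy sequences in capacity\<close>

text \<open>
  A sequence whose increments act on laws like those of the partial sums of independent
  variables, and whose laws are tight and converge. The property is invariant under \<open>Z \<mapsto> - Z\<close>.
\<close>

locale convergent_laws = sublinear_functional \<Omega> F
  for \<Omega> :: "'a set" and F :: "('a \<Rightarrow> real) \<Rightarrow> real" +
  fixes Z :: "nat \<Rightarrow> 'a \<Rightarrow> real"
  assumes increment: "1 \<le> n \<Longrightarrow> n \<le> m \<Longrightarrow> bounded_lipschitz \<phi> \<Longrightarrow>
      F (\<lambda>\<omega>. \<phi> (Z m \<omega>)) = F (\<lambda>\<omega>. F (\<lambda>\<omega>'. \<phi> (Z n \<omega> + (Z m \<omega>' - Z n \<omega>'))))"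
    and laws_tight: "\<eta> > 0 \<Longrightarrow> \<exists>K\<ge>0. \<forall>\<^sub>F n in sequentially. F (\<lambda>\<omega>. tail_cutoff K (Z n \<omega>)) \<le> \<eta>"
    and laws_Cauchy: "bounded_lipschitz \<phi> \<Longrightarrow> Cauchy (\<lambda>n. F (\<lambda>\<omega>. \<phi> (Z n \<omega>)))"
begin

lemma reflect: "convergent_laws \<Omega> F (\<lambda>n \<omega>. - Z n \<omega>)"
proof
  have bl: "bounded_lipschitz (\<lambda>x. \<phi> (- x))" if \<phi>: "bounded_lipschitz \<phi>" for \<phi>
  proof -
    obtain C where "0 \<le> C" "\<And>x y. \<bar>\<phi> x - \<phi> y\<bar> \<le> C * \<bar>x - y\<bar>"
      using \<phi> unfolding bounded_lipschitz_def lipschitz_on_UNIV_real_iff by blast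
    then have "\<bar>\<phi> (- x) - \<phi> (- y)\<bar> \<le> C * \<bar>x - y\<bar>" for x y
      by (metis abs_minus_commute minus_diff_eq minus_diff_minus)
    then show ?thesis
      using \<open>0 \<le> C\<close> bounded_lipschitz_bounded_fun[OF \<phi>]
      unfolding bounded_lipschitz_def lipschitz_on_UNIV_real_iff by blast
  qed
  show "F (\<lambda>\<omega>. \<phi> (- Z m \<omega>)) = F (\<lambda>\<omega>. F (\<lambda>\<omega>'. \<phi> (- Z n \<omega> + (- Z m \<omega>' - - Z n \<omega>'))))"
    if "1 \<le> n" "n \<le> m" "bounded_lipschitz \<phi>" for n m \<phi>
    using increment[OF that(1,2) bl[OF that(3)]] by (simp add: algebra_simps)
  show "\<exists>K\<ge>0. \<forall>\<^sub>F n in sequentially. F (\<lambda>\<omega>. tail_cutoff K (- Z n \<omega>)) \<le> \<eta>" if "\<eta> > 0" for \<eta>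
    using laws_tight[OF that] by (simp add: tail_cutoff_def)
  show "Cauchy (\<lambda>n. F (\<lambda>\<omega>. \<phi> (- Z n \<omega>)))" if "bounded_lipschitz \<phi>" for \<phi>
    using laws_Cauchy[OF bl[OF that]] .
qed

text \<open>
  Convergence of the laws is uniform over the unit ball of bounded Lipschitz functions, which is
  totally bounded up to the tails that tightness controls.
\<close>

lemma laws_uniformly_Cauchy:
  assumes "\<gamma> > 0"
  obtains N where "\<And>n m \<phi>. N \<le> n \<Longrightarrow> N \<le> m \<Longrightarrow> (\<And>x. \<bar>\<phi> x\<bar> \<le> 1) \<Longrightarrow> 1-lipschitz_on UNIV \<phi> \<Longrightarrow>
      F (\<lambda>\<omega>. \<phi> (Z m \<omega>)) \<le> F (\<lambda>\<omega>. \<phi> (Z n \<omega>)) + \<gamma>"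
proof -
  (* Below, passing to the net and back costs 5 * eta each way, and the Cauchy property on the
     net costs another eta. *)
  define \<eta> where "\<eta> = \<gamma> / 11"
  have "\<eta> > 0" using assms by (simp add: \<eta>_def)
  obtain K where "0 \<le> K" and K: "\<forall>\<^sub>F n in sequentially. F (\<lambda>\<omega>. tail_cutoff K (Z n \<omega>)) \<le> \<eta>"
    using laws_tight[OF \<open>\<eta> > 0\<close>] by blast
  obtain \<Psi> where \<Psi>: "finite \<Psi>" "\<Psi> \<subseteq> {\<phi>. (\<forall>x. \<bar>\<phi> x\<bar> \<le> 1) \<and> 1-lipschitz_on UNIV \<phi>}"
    and net: "\<forall>\<phi>\<in>{\<phi>. (\<forall>x. \<bar>\<phi> x\<bar> \<le> 1) \<and> 1-lipschitz_on UNIV \<phi>}.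
        \<exists>\<psi>\<in>\<Psi>. \<forall>x. \<bar>x\<bar> \<le> K + 1 \<longrightarrow> \<bar>\<phi> x - \<psi> x\<bar> \<le> 3 * \<eta>"
    using finite_net_bounded_lipschitz[OF \<open>\<eta> > 0\<close>, of "K + 1"] by (elim exE conjE)
  have b: "bounded_fun \<Omega> (\<lambda>\<omega>. \<phi> (Z i \<omega>))" if "\<And>x. \<bar>\<phi> x\<bar> \<le> 1" for \<phi> i
    by (rule bounded_funI[of _ _ 1]) (rule that)
  have "\<forall>\<psi>\<in>\<Psi>. \<forall>\<^sub>F N in sequentially. \<forall>n\<ge>N. \<forall>m\<ge>N.
      \<bar>F (\<lambda>\<omega>. \<psi> (Z m \<omega>)) - F (\<lambda>\<omega>. \<psi> (Z n \<omega>))\<bar> \<le> \<eta>"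
  proof
    fix \<psi> assume "\<psi> \<in> \<Psi>"
    then have "bounded_lipschitz \<psi>"
      using \<Psi>(2) unfolding bounded_lipschitz_def by (auto intro: bounded_funI)
    from metric_CauchyD[OF laws_Cauchy[OF this] \<open>\<eta> > 0\<close>] obtain N where
      "\<forall>m\<ge>N. \<forall>n\<ge>N. dist (F (\<lambda>\<omega>. \<psi> (Z m \<omega>))) (F (\<lambda>\<omega>. \<psi> (Z n \<omega>))) < \<eta>" by blast
    then have "\<forall>N'\<ge>N. \<forall>n\<ge>N'. \<forall>m\<ge>N'. \<bar>F (\<lambda>\<omega>. \<psi> (Z m \<omega>)) - F (\<lambda>\<omega>. \<psi> (Z n \<omega>))\<bar> \<le> \<eta>"
      unfolding dist_real_def by (auto intro!: less_imp_le)
    then show "\<forall>\<^sub>F N in sequentially. \<forall>n\<ge>N. \<forall>m\<ge>N.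
        \<bar>F (\<lambda>\<omega>. \<psi> (Z m \<omega>)) - F (\<lambda>\<omega>. \<psi> (Z n \<omega>))\<bar> \<le> \<eta>"
      unfolding eventually_sequentially by blast
  qed
  then have "\<forall>\<^sub>F N in sequentially. \<forall>\<psi>\<in>\<Psi>. \<forall>n\<ge>N. \<forall>m\<ge>N.
      \<bar>F (\<lambda>\<omega>. \<psi> (Z m \<omega>)) - F (\<lambda>\<omega>. \<psi> (Z n \<omega>))\<bar> \<le> \<eta>"
    by (rule eventually_ball_finite[OF \<Psi>(1)])
  then obtain N1 where N1: "\<And>\<psi> n m. \<psi> \<in> \<Psi> \<Longrightarrow> N1 \<le> n \<Longrightarrow> N1 \<le> m \<Longrightarrow>
      \<bar>F (\<lambda>\<omega>. \<psi> (Z m \<omega>)) - F (\<lambda>\<omega>. \<psi> (Z n \<omega>))\<bar> \<le> \<eta>"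
    unfolding eventually_sequentially by blast
  obtain N2 where N2: "\<And>n. N2 \<le> n \<Longrightarrow> F (\<lambda>\<omega>. tail_cutoff K (Z n \<omega>)) \<le> \<eta>"
    using K unfolding eventually_sequentially by blast
  show thesis
  proof (rule that[of "max N1 N2"])
    fix n m and \<phi> :: "real \<Rightarrow> real"
    assume nm: "max N1 N2 \<le> n" "max N1 N2 \<le> m"
      and \<phi>: "\<And>x. \<bar>\<phi> x\<bar> \<le> 1" "1-lipschitz_on UNIV \<phi>"
    obtain \<psi> where "\<psi> \<in> \<Psi>" and near: "\<And>x. \<bar>x\<bar> \<le> K + 1 \<Longrightarrow> \<bar>\<phi> x - \<psi> x\<bar> \<le> 3 * \<eta>"
      using bspec[OF net, of \<phi>] \<phi> by blast
    have \<psi>: "\<bar>\<psi> x\<bar> \<le> 1" for x using \<Psi>(2) \<open>\<psi> \<in> \<Psi>\<close> by blast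
    have "\<bar>\<phi> x - \<psi> x\<bar> \<le> 2 * tail_cutoff K x + 3 * \<eta>" for x
    proof (cases "\<bar>x\<bar> \<le> K + 1")
      case True
      then show ?thesis using near[of x] tail_cutoff_bounds(1)[of K x] by linarith
    next
      case False
      then have "tail_cutoff K x = 1" by (simp add: tail_cutoff_def)
      then show ?thesis using \<phi>(1)[of x] \<psi>[of x] \<open>\<eta> > 0\<close> by linarith
    qed
    then have ptw: "\<phi> x \<le> \<psi> x + (2 * tail_cutoff K x + 3 * \<eta>)"
        "\<psi> x \<le> \<phi> x + (2 * tail_cutoff K x + 3 * \<eta>)" for x
      by (simp_all add: abs_le_iff algebra_simps)
    have tail: "F (\<lambda>\<omega>. 2 * tail_cutoff K (Z i \<omega>) + 3 * \<eta>) \<le> 5 * \<eta>" if "N2 \<le> i" for i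
      using N2[OF that] by (simp add: add_const scale bounded_fun_rules bounded_fun_tail_cutoff)
    have bt: "bounded_fun \<Omega> (\<lambda>\<omega>. 2 * tail_cutoff K (Z i \<omega>) + 3 * \<eta>)" for i
      by (intro bounded_fun_rules bounded_fun_tail_cutoff)
    have "F (\<lambda>\<omega>. \<phi> (Z m \<omega>)) \<le> F (\<lambda>\<omega>. \<psi> (Z m \<omega>)) + F (\<lambda>\<omega>. 2 * tail_cutoff K (Z m \<omega>) + 3 * \<eta>)"
      by (intro add_le b bt ptw(1) \<phi>(1) \<psi>)
    moreover have "F (\<lambda>\<omega>. \<psi> (Z n \<omega>)) \<le> F (\<lambda>\<omega>. \<phi> (Z n \<omega>)) + F (\<lambda>\<omega>. 2 * tail_cutoff K (Z n \<omega>) + 3 * \<eta>)"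
      by (intro add_le b bt ptw(2) \<phi>(1) \<psi>)
    moreover have "\<bar>F (\<lambda>\<omega>. \<psi> (Z m \<omega>)) - F (\<lambda>\<omega>. \<psi> (Z n \<omega>))\<bar> \<le> \<eta>"
      by (rule N1[OF \<open>\<psi> \<in> \<Psi>\<close>]) (use nm in auto)
    moreover have "F (\<lambda>\<omega>. 2 * tail_cutoff K (Z n \<omega>) + 3 * \<eta>) \<le> 5 * \<eta>"
        "F (\<lambda>\<omega>. 2 * tail_cutoff K (Z m \<omega>) + 3 * \<eta>) \<le> 5 * \<eta>"
      using tail nm by auto
    moreover have "11 * \<eta> = \<gamma>" by (simp add: \<eta>_def)
    ultimately show "F (\<lambda>\<omega>. \<phi> (Z m \<omega>)) \<le> F (\<lambda>\<omega>. \<phi> (Z n \<omega>)) + \<gamma>" by linarith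
  qed
qed

text \<open>
  For large \<open>n \<le> m\<close>, one step with the law of \<open>Z m - Z n\<close> turns the law of \<open>Z n\<close> into that of
  \<open>Z m\<close>, which is nearly the law of \<open>Z n\<close>. Uniformity makes the same step repeatable any
  prescribed number of times at small cost, so the walk stays tight, and large steps to the right
  are unlikely.
\<close>

lemma increments_small_right:
  assumes "e > 0" "\<delta> > 0"
  shows "\<exists>N\<ge>1. \<forall>n\<ge>N. \<forall>m\<ge>n. F (\<lambda>\<omega>. indicator {e..} (Z m \<omega> - Z n \<omega>)) < \<delta>"
proof -
  define d where "d = min \<delta> (1 / 2)"
  have d: "0 < d" "d \<le> 1" "d \<le> \<delta>" using assms by (auto simp: d_def)
  obtain K where "0 \<le> K" and K: "\<forall>\<^sub>F n in sequentially. F (\<lambda>\<omega>. tail_cutoff K (Z n \<omega>)) \<le> 1 / 16"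
    using laws_tight[of "1 / 16"] by auto
  obtain N0 where N0: "\<And>n. N0 \<le> n \<Longrightarrow> F (\<lambda>\<omega>. tail_cutoff K (Z n \<omega>)) \<le> 1 / 16"
    using K unfolding eventually_sequentially by blast
  obtain L where L: "2 * (3 * K + 1) \<le> real L * e"
    using reals_Archimedean3[OF \<open>e > 0\<close>] by (meson less_imp_le)
  have "1 - d ^ L < 1" using d by simp
  then obtain k where k: "(1 - d ^ L) ^ k < 1 / 2"
    using real_arch_pow_inv[of "1 / 2" "1 - d ^ L"] by auto
  (* k * L steps then cost at most 1 / 16, on top of the initial tail of at most 1 / 16. *)
  define \<gamma> where "\<gamma> = 1 / (16 * real (k * L + 1))"
  have "\<gamma> > 0" unfolding \<gamma>_def by (intro divide_pos_pos mult_pos_pos of_nat_0_less_iff[THEN iffD2]) auto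
  then obtain N1 where N1: "\<And>n m \<phi>. N1 \<le> n \<Longrightarrow> N1 \<le> m \<Longrightarrow> (\<And>x. \<bar>\<phi> x\<bar> \<le> 1) \<Longrightarrow>
      1-lipschitz_on UNIV \<phi> \<Longrightarrow> F (\<lambda>\<omega>. \<phi> (Z m \<omega>)) \<le> F (\<lambda>\<omega>. \<phi> (Z n \<omega>)) + \<gamma>"
    by (rule laws_uniformly_Cauchy) blast
  show ?thesis
  proof (intro exI[of _ "max 1 (max N0 N1)"] conjI allI impI)
    fix n m assume nm: "max 1 (max N0 N1) \<le> n" "n \<le> m"
    let ?A = "\<lambda>\<phi>. F (\<lambda>\<omega>. \<phi> (Z n \<omega>))"
    let ?Y = "\<lambda>\<phi>. F (\<lambda>\<omega>. \<phi> (Z m \<omega> - Z n \<omega>))"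
    let ?T = "\<lambda>j. (walk_step ?Y ^^ j) (tail_cutoff K)"
    have Y: "sublinear_functional UNIV ?Y" by (rule law)
    have T: "\<bar>?T j x\<bar> \<le> 1" "1-lipschitz_on UNIV (?T j)" for j x
      by (rule walk_iter_abs_le[OF Y tail_cutoff_bounds(3)])
        (rule walk_iter_lipschitz[OF Y bounded_fun_tail_cutoff tail_cutoff_lipschitz])
    have "?A (?T j) \<le> ?A (tail_cutoff K) + real j * \<gamma>" for j
    proof (induction j)
      case (Suc j)
      have "bounded_lipschitz (?T j)"
        unfolding bounded_lipschitz_def using T(2)[of j] bounded_funI[OF T(1)[of j]] by auto
      then have "?A (?T (Suc j)) = F (\<lambda>\<omega>. ?T j (Z m \<omega>))"
        using nm by (subst increment[of n m]) (simp_all add: walk_step_def[of ?Y "_ _"])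
      also have "\<dots> \<le> ?A (?T j) + \<gamma>" by (rule N1[OF _ _ T]) (use nm in auto)
      finally show ?case using Suc by (simp add: algebra_simps)
    qed simp
    moreover have "real j * \<gamma> \<le> 1 / 16" if "j \<le> k * L" for j
      using of_nat_mono[OF that, where 'a = real]
      unfolding \<gamma>_def by (simp add: field_simps)
    moreover have "?A (tail_cutoff K) \<le> 1 / 16" by (rule N0) (use nm in simp)
    ultimately have "?A (?T j) \<le> 1 / 16 + 1 / 16" if "j \<le> k * L" for j
      using that by (meson add_mono order_trans)
    then have "?Y (indicator {e..}) < d"
      by (intro walk_not_tight[OF Y law _ \<open>0 \<le> K\<close> _ d(2) L]) (use d less_imp_le[OF k] in auto)
    then show "F (\<lambda>\<omega>. indicator {e..} (Z m \<omega> - Z n \<omega>)) < \<delta>" using d by simp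
  qed simp
qed

lemma increments_small:
  assumes "e > 0" "\<delta> > 0"
  shows "\<exists>N\<ge>1. \<forall>n\<ge>N. \<forall>m\<ge>n. F (\<lambda>\<omega>. indicator {e..} \<bar>Z m \<omega> - Z n \<omega>\<bar>) < \<delta>"
proof -
  interpret neg: convergent_laws \<Omega> F "\<lambda>n \<omega>. - Z n \<omega>" by (rule reflect)
  have "\<delta> / 2 > 0" using assms by simp
  obtain N1 where N1: "1 \<le> N1" "\<forall>n\<ge>N1. \<forall>m\<ge>n.
      F (\<lambda>\<omega>. indicator {e..} (Z m \<omega> - Z n \<omega>)) < \<delta> / 2"
    using increments_small_right[OF assms(1) \<open>\<delta> / 2 > 0\<close>] by (elim exE conjE)
  obtain N2 where "1 \<le> N2" and N2: "\<forall>n\<ge>N2. \<forall>m\<ge>n.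
      F (\<lambda>\<omega>. indicator {e..} (- Z m \<omega> - - Z n \<omega>)) < \<delta> / 2"
    using neg.increments_small_right[OF assms(1) \<open>\<delta> / 2 > 0\<close>] by (elim exE conjE)
  show ?thesis
  proof (intro exI[of _ "max N1 N2"] conjI allI impI)
    fix n m assume nm: "max N1 N2 \<le> n" "n \<le> m"
    have "F (\<lambda>\<omega>. indicator {e..} \<bar>Z m \<omega> - Z n \<omega>\<bar>)
        \<le> F (\<lambda>\<omega>. indicator {e..} (Z m \<omega> - Z n \<omega>)) + F (\<lambda>\<omega>. indicator {e..} (- Z m \<omega> - - Z n \<omega>))"
      by (intro add_le bounded_fun_rules) (auto simp: indicator_def)
    then show "F (\<lambda>\<omega>. indicator {e..} \<bar>Z m \<omega> - Z n \<omega>\<bar>) < \<delta>"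
      using N1(2) N2 nm by fastforce
  qed (use N1 in simp)
qed

end

section \<open>Partial sums of independent random variables\<close>

lemma C_b_Lip_iff:
  "\<Phi> \<in> C_b_Lip n \<longleftrightarrow> (\<exists>B. \<forall>x. \<bar>\<Phi> x\<bar> \<le> B) \<and>
     (\<exists>C\<ge>0. \<forall>x y. \<bar>\<Phi> x - \<Phi> y\<bar> \<le> C * L2_set (\<lambda>i. x i - y i) {..<n})"
proof -
  have "\<exists>C>0. \<forall>x y. \<bar>\<Phi> x - \<Phi> y\<bar> \<le> C * L2_set (\<lambda>i. x i - y i) {..<n}"
    if "0 \<le> C" "\<forall>x y. \<bar>\<Phi> x - \<Phi> y\<bar> \<le> C * L2_set (\<lambda>i. x i - y i) {..<n}" for C
  proof (intro exI[of _ "C + 1"] conjI allI)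
    fix x y
    have "\<bar>\<Phi> x - \<Phi> y\<bar> \<le> C * L2_set (\<lambda>i. x i - y i) {..<n}" using that by blast
    also have "\<dots> \<le> (C + 1) * L2_set (\<lambda>i. x i - y i) {..<n}"
      by (intro mult_right_mono) auto
    finally show "\<bar>\<Phi> x - \<Phi> y\<bar> \<le> (C + 1) * L2_set (\<lambda>i. x i - y i) {..<n}" .
  qed (use that in simp)
  then show ?thesis
    unfolding C_b_Lip_def bounded_iff by (auto intro: less_imp_le)
qed

lemma C_b_Lip_const: "(\<lambda>_. c) \<in> C_b_Lip n"
  unfolding C_b_Lip_iff by auto

lemma C_b_Lip_add:
  assumes "\<Phi> \<in> C_b_Lip n" "\<Psi> \<in> C_b_Lip n"
  shows "(\<lambda>x. \<Phi> x + \<Psi> x) \<in> C_b_Lip n"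
proof -
  let ?d = "\<lambda>x y. L2_set (\<lambda>i. x i - y i) {..<n}"
  obtain B C B' C' where *: "\<And>x. \<bar>\<Phi> x\<bar> \<le> B" "0 \<le> C" "\<And>x y. \<bar>\<Phi> x - \<Phi> y\<bar> \<le> C * ?d x y"
    "\<And>x. \<bar>\<Psi> x\<bar> \<le> B'" "0 \<le> C'" "\<And>x y. \<bar>\<Psi> x - \<Psi> y\<bar> \<le> C' * ?d x y"
    using assms unfolding C_b_Lip_iff by blast
  have "\<bar>\<Phi> x + \<Psi> x\<bar> \<le> B + B'" for x using *(1,4)[of x] by linarith
  moreover have "\<bar>(\<Phi> x + \<Psi> x) - (\<Phi> y + \<Psi> y)\<bar> \<le> (C + C') * ?d x y" for x y
    unfolding distrib_right using *(3,6)[of x y] by linarith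
  ultimately show ?thesis unfolding C_b_Lip_iff using *(2,5) by (meson add_nonneg_nonneg)
qed

lemma C_b_Lip_mult:
  assumes "\<Phi> \<in> C_b_Lip n" "\<Psi> \<in> C_b_Lip n"
  shows "(\<lambda>x. \<Phi> x * \<Psi> x) \<in> C_b_Lip n"
proof -
  let ?d = "\<lambda>x y. L2_set (\<lambda>i. x i - y i) {..<n}"
  obtain B C B' C' where *: "\<And>x. \<bar>\<Phi> x\<bar> \<le> B" "0 \<le> C" "\<And>x y. \<bar>\<Phi> x - \<Phi> y\<bar> \<le> C * ?d x y"
    "\<And>x. \<bar>\<Psi> x\<bar> \<le> B'" "0 \<le> C'" "\<And>x y. \<bar>\<Psi> x - \<Psi> y\<bar> \<le> C' * ?d x y"
    using assms unfolding C_b_Lip_iff by blast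
  have "0 \<le> B" "0 \<le> B'" using *(1,4)[of undefined] by linarith+
  have "\<bar>\<Phi> x * \<Psi> x\<bar> \<le> B * B'" for x
    unfolding abs_mult using *(1,4) \<open>0 \<le> B\<close> by (intro mult_mono) auto
  moreover have "\<bar>\<Phi> x * \<Psi> x - \<Phi> y * \<Psi> y\<bar> \<le> (B * C' + C * B') * ?d x y" for x y
  proof -
    have "\<Phi> x * \<Psi> x - \<Phi> y * \<Psi> y = \<Phi> x * (\<Psi> x - \<Psi> y) + (\<Phi> x - \<Phi> y) * \<Psi> y"
      by (simp add: algebra_simps)
    also have "\<bar>\<dots>\<bar> \<le> \<bar>\<Phi> x\<bar> * \<bar>\<Psi> x - \<Psi> y\<bar> + \<bar>\<Phi> x - \<Phi> y\<bar> * \<bar>\<Psi> y\<bar>"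
      by (metis abs_mult abs_triangle_ineq)
    also have "\<dots> \<le> B * (C' * ?d x y) + (C * ?d x y) * B'"
      using * \<open>0 \<le> B\<close> \<open>0 \<le> B'\<close> by (intro add_mono mult_mono) auto
    finally show ?thesis by (simp add: algebra_simps)
  qed
  moreover have "0 \<le> B * C' + C * B'" using \<open>0 \<le> B\<close> \<open>0 \<le> B'\<close> *(2,5) by simp
  ultimately show ?thesis unfolding C_b_Lip_iff by blast
qed

lemma C_b_Lip_prod:
  "finite I \<Longrightarrow> (\<And>i. i \<in> I \<Longrightarrow> \<Phi> i \<in> C_b_Lip n) \<Longrightarrow> (\<lambda>x. \<Prod>i\<in>I. \<Phi> i x) \<in> C_b_Lip n"
  by (induction I rule: finite_induct) (simp_all add: C_b_Lip_const C_b_Lip_mult)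

lemma C_b_Lip_sum:
  assumes \<phi>: "bounded_lipschitz \<phi>" and J: "J \<subseteq> {..<n}"
  shows "(\<lambda>v. \<phi> (x + (\<Sum>k\<in>J. v k))) \<in> C_b_Lip n"
proof -
  obtain B C where B: "\<And>x. \<bar>\<phi> x\<bar> \<le> B" and C: "0 \<le> C" "\<And>x y. \<bar>\<phi> x - \<phi> y\<bar> \<le> C * \<bar>x - y\<bar>"
    using \<phi> unfolding bounded_lipschitz_def bounded_fun_def lipschitz_on_UNIV_real_iff by blast
  have "\<bar>\<phi> (x + sum v J) - \<phi> (x + sum w J)\<bar> \<le> (C * real (card J)) * L2_set (\<lambda>i. v i - w i) {..<n}"
    for v w
  proof -
    have "\<bar>\<phi> (x + sum v J) - \<phi> (x + sum w J)\<bar> \<le> C * \<bar>\<Sum>k\<in>J. v k - w k\<bar>"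
      using C(2)[of "x + sum v J" "x + sum w J"] by (simp add: sum_subtractf)
    also have "\<bar>\<Sum>k\<in>J. v k - w k\<bar> \<le> (\<Sum>k\<in>J. \<bar>v k - w k\<bar>)" by (rule sum_abs)
    also have "\<dots> \<le> (\<Sum>k\<in>J. L2_set (\<lambda>i. v i - w i) {..<n})"
    proof (rule sum_mono)
      fix k assume "k \<in> J"
      then have "\<bar>v k - w k\<bar> \<le> L2_set (\<lambda>i. \<bar>v i - w i\<bar>) {..<n}"
        using J by (intro member_le_L2_set) auto
      then show "\<bar>v k - w k\<bar> \<le> L2_set (\<lambda>i. v i - w i) {..<n}" by (simp add: L2_set_def)
    qed
    finally show ?thesis using C(1) by (simp add: mult_left_mono mult.assoc)
  qed
  moreover have "0 \<le> C * real (card J)" using C(1) by simp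
  ultimately show ?thesis unfolding C_b_Lip_iff using B by blast
qed

lemma bounded_lipschitz_tail_cutoff_scale: "bounded_lipschitz (\<lambda>x. tail_cutoff K (a * x))"
proof -
  have "\<bar>tail_cutoff K (a * x) - tail_cutoff K (a * y)\<bar> \<le> \<bar>a\<bar> * \<bar>x - y\<bar>" for x y
    using tail_cutoff_lipschitz[of K]
    unfolding lipschitz_on_UNIV_real_iff by (metis abs_mult mult_1 right_diff_distrib)
  then show ?thesis
    unfolding bounded_lipschitz_def lipschitz_on_UNIV_real_iff
    using bounded_fun_tail_cutoff abs_ge_zero by blast
qed

lemma partial_sum_diff:
  assumes "l \<le> n"
  shows "partial_sum X n \<omega> - partial_sum X l \<omega> = (\<Sum>k\<in>{l..<n}. X (k + 1) \<omega>)"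
proof -
  have "partial_sum X j \<omega> = (\<Sum>k<j. X (k + 1) \<omega>)" for j
    unfolding partial_sum_def by (simp add: sum.atLeast1_atMost_eq)
  moreover have "{l..<n} = {..<n} - {..<l}" by auto
  moreover have "(\<Sum>k\<in>{..<n} - {..<l}. X (k + 1) \<omega>) = (\<Sum>k<n. X (k + 1) \<omega>) - (\<Sum>k<l. X (k + 1) \<omega>)"
    by (rule sum_diff) (use assms in auto)
  ultimately show ?thesis by simp
qed

lemma partial_sum_Suc: "partial_sum X (Suc n) \<omega> = partial_sum X n \<omega> + X (Suc n) \<omega>"
  by (simp add: partial_sum_def)

locale independent_sums = sublinear_functional \<Omega> F
  for \<Omega> :: "'a set" and F :: "('a \<Rightarrow> real) \<Rightarrow> real" +
  fixes X :: "nat \<Rightarrow> 'a \<Rightarrow> real"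
  assumes independent: "1 \<le> i \<Longrightarrow> \<Phi> \<in> C_b_Lip (i + 1) \<Longrightarrow>
      F (\<lambda>\<omega>. \<Phi> (vec_append i (\<lambda>j. X (j + 1) \<omega>) (\<lambda>_. X (i + 1) \<omega>))) =
      F (\<lambda>\<omega>. F (\<lambda>\<omega>'. \<Phi> (vec_append i (\<lambda>j. X (j + 1) \<omega>) (\<lambda>_. X (i + 1) \<omega>'))))"
begin

abbreviation S :: "nat \<Rightarrow> 'a \<Rightarrow> real" where "S \<equiv> partial_sum X"

lemma average_bounded_lipschitz:
  "bounded_lipschitz \<phi> \<Longrightarrow> bounded_lipschitz (\<lambda>z. F (\<lambda>\<omega>. \<phi> (z + Y \<omega>)))"
  using bounded_lipschitz_walk_step[OF law[of Y], of \<phi>] unfolding walk_step_def .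

lemma independent_next:
  assumes i: "1 \<le> i" "l \<le> i" and \<phi>: "bounded_lipschitz \<phi>"
  shows "F (\<lambda>\<omega>. \<phi> (x + (S i \<omega> - S l \<omega>) + X (Suc i) \<omega>)) =
         F (\<lambda>\<omega>. F (\<lambda>\<omega>'. \<phi> (x + (S i \<omega> - S l \<omega>) + X (Suc i) \<omega>')))"
proof -
  have *: "(\<Sum>k\<in>{l..<i + 1}. vec_append i (\<lambda>j. X (j + 1) \<omega>) (\<lambda>_. z) k) = S i \<omega> - S l \<omega> + z" for \<omega> z
    using i(2) by (simp add: partial_sum_diff vec_append_def)
  have "(\<lambda>v. \<phi> (x + (\<Sum>k\<in>{l..<i + 1}. v k))) \<in> C_b_Lip (i + 1)"
    by (rule C_b_Lip_sum[OF \<phi>]) auto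
  from independent[OF i(1) this] show ?thesis
    unfolding * by (simp only: add.assoc Suc_eq_plus1)
qed

text \<open>
  The increment over \<open>{n<..m}\<close> is independent of that over \<open>{l<..n}\<close>. Independence is given
  only for the last variable, so the variables of the second block are split off one by one.
\<close>

lemma independent_increments:
  assumes "1 \<le> n" "l \<le> n" "n \<le> m" "bounded_lipschitz \<phi>"
  shows "F (\<lambda>\<omega>. \<phi> (x + (S m \<omega> - S l \<omega>))) =
         F (\<lambda>\<omega>. F (\<lambda>\<omega>'. \<phi> (x + (S n \<omega> - S l \<omega>) + (S m \<omega>' - S n \<omega>'))))"
  using assms(3,4)
proof (induction m arbitrary: \<phi> x rule: dec_induct)
  case base
  show ?case by (simp add: const)
next
  case (step m)
  define \<Psi> where "\<Psi> = (\<lambda>z. F (\<lambda>\<omega>. \<phi> (z + X (Suc m) \<omega>)))"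
  have \<Psi>: "bounded_lipschitz \<Psi>"
    unfolding \<Psi>_def by (rule average_bounded_lipschitz[OF step.prems])
  have m: "1 \<le> m" "l \<le> m" using assms step.hyps by auto
  have "F (\<lambda>\<omega>. \<phi> (x + (S (Suc m) \<omega> - S l \<omega>))) = F (\<lambda>\<omega>. \<Psi> (x + (S m \<omega> - S l \<omega>)))"
    using independent_next[OF m step.prems, of x]
    by (simp add: \<Psi>_def partial_sum_Suc algebra_simps)
  also have "\<dots> = F (\<lambda>\<omega>. F (\<lambda>\<omega>'. \<Psi> (x + (S n \<omega> - S l \<omega>) + (S m \<omega>' - S n \<omega>'))))"
    by (rule step.IH[OF \<Psi>])
  also have "\<dots> = F (\<lambda>\<omega>. F (\<lambda>\<omega>'. \<phi> (x + (S n \<omega> - S l \<omega>) + (S (Suc m) \<omega>' - S n \<omega>'))))"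
    unfolding \<Psi>_def independent_next[OF m(1) step.hyps(1) step.prems, symmetric]
    by (simp add: partial_sum_Suc algebra_simps)
  finally show ?case .
qed

text \<open>
  Ottaviani's inequality. Classically one stops when \<open>S k - S n\<close> has become large for the first
  time; the remaining increment is independent and probably small, so \<open>S m - S n\<close> is still large
  at the end. Here the stopping decision is smoothed to stay within Lipschitz functions: the
  product \<open>P j\<close> of the factors \<open>1 - f (S k - S n)\<close> is the weight of not having stopped up to
  time \<open>j\<close>, and \<open>u j y\<close> measures how likely \<open>S m - S n\<close> is to be large if \<open>S j - S n = y\<close>. The
  game with value \<open>D j\<close> pays 1 to those who have stopped by time \<open>j\<close> and \<open>2 * u j (S j - S n)\<close>
  to the others. Since \<open>u\<close> is constant on average, going from \<open>j\<close> to \<open>j + 1\<close> only replaces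
  \<open>2 * u\<close> by 1 for those who stop at \<open>j + 1\<close>, and for them \<open>1 \<le> 2 * u\<close>; so \<open>D\<close> decreases from
  twice the value of a large final increment to at least the capacity of ever stopping.
\<close>

lemma ottaviani:
  assumes "a > 0" "1 \<le> n" "n \<le> m"
    and half: "\<And>k. n \<le> k \<Longrightarrow> k \<le> m \<Longrightarrow> F (\<lambda>\<omega>. tail_cutoff 0 (a * (S m \<omega> - S k \<omega>))) \<le> 1 / 2"
  shows "F (indicator {\<omega>. \<exists>k\<in>{n<..m}. 2 / a \<le> \<bar>S k \<omega> - S n \<omega>\<bar>})
         \<le> 2 * F (\<lambda>\<omega>. tail_cutoff 0 (a * (S m \<omega> - S n \<omega>)))"
proof -
  define \<rho> where "\<rho> = (\<lambda>x. tail_cutoff 0 (a * x))"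
  define f where "f = (\<lambda>x. tail_cutoff 1 (a * x))"
  define u where "u = (\<lambda>j y. F (\<lambda>\<omega>. \<rho> (y + (S m \<omega> - S j \<omega>))))"
  define P where "P = (\<lambda>j \<omega>. \<Prod>k\<in>{n<..j}. 1 - f (S k \<omega> - S n \<omega>))"
  define D where "D = (\<lambda>j. F (\<lambda>\<omega>. 1 + P j \<omega> * (2 * u j (S j \<omega> - S n \<omega>) - 1)))"
  have \<rho>: "bounded_lipschitz \<rho>" "\<And>x. 0 \<le> \<rho> x" "\<And>x. \<rho> x \<le> 1"
    and f: "bounded_lipschitz f" "\<And>x. 0 \<le> f x" "\<And>x. f x \<le> 1"
    by (simp_all add: \<rho>_def f_def bounded_lipschitz_tail_cutoff_scale tail_cutoff_bounds)
  have b\<rho>: "bounded_fun \<Omega> (\<lambda>\<omega>. \<rho> (Y \<omega>))" for Y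
    by (rule bounded_lipschitz_bounded_fun[OF \<rho>(1)])
  have u: "bounded_lipschitz (u j)" "0 \<le> u j y" "u j y \<le> 1" for j y
    unfolding u_def
    by (rule average_bounded_lipschitz[OF \<rho>(1)] ge_const[OF b\<rho>] le_const[OF b\<rho>]; rule \<rho>)+
  have P: "0 \<le> P j \<omega>" "P j \<omega> \<le> 1" for j \<omega>
    unfolding P_def by (auto intro!: prod_nonneg prod_le_1 simp: f)
  have bP: "bounded_fun \<Omega> (\<lambda>\<omega>. P j \<omega>)" for j
    by (rule bounded_funI[of _ _ 1]) (use P in simp)
  have bu: "bounded_fun \<Omega> (\<lambda>\<omega>. u j (Y \<omega>))" for j Y
    by (rule bounded_lipschitz_bounded_fun[OF u(1)])
  have bD: "bounded_fun \<Omega> (\<lambda>\<omega>. 1 + P i \<omega> * (2 * u j (Y \<omega>) - 1))" for i j Y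
    unfolding diff_conv_add_uminus by (intro bounded_fun_rules bP bu)
  have stop: "1 \<le> 2 * u j y" if "f y \<noteq> 0" "n \<le> j" "j \<le> m" for j y
  proof -
    have "1 < \<bar>a * y\<bar>" using that(1) by (auto simp: f_def tail_cutoff_def min_def max_def split: if_splits)
    then have "1 \<le> \<rho> (y + w) + \<rho> w" for w
      using abs_triangle_ineq[of "a * (y + w)" "- (a * w)"]
      by (auto simp: \<rho>_def tail_cutoff_def min_def max_def algebra_simps)
    then have "F (\<lambda>_. 1) \<le> u j y + F (\<lambda>\<omega>. \<rho> (S m \<omega> - S j \<omega>))"
      unfolding u_def by (intro add_le b\<rho> bounded_fun_const)
    then show ?thesis using half[OF that(2,3)] by (simp add: const \<rho>_def)
  qed
  have decreasing: "D (Suc j) \<le> D j" if j: "n \<le> j" "Suc j \<le> m" for j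
  proof -
    have Suc_j: "{n<..Suc j} = insert (Suc j) {n<..j}" using j by auto
    have ptw: "1 + P (Suc j) \<omega> * (2 * u (Suc j) y - 1) \<le> 1 + P j \<omega> * (2 * u (Suc j) y - 1)"
      if "y = S (Suc j) \<omega> - S n \<omega>" for \<omega> y
    proof -
      have Pj: "P (Suc j) \<omega> = P j \<omega> * (1 - f y)"
        unfolding P_def Suc_j by (simp add: that algebra_simps)
      have "P (Suc j) \<omega> * (2 * u (Suc j) y - 1)
          = P j \<omega> * (2 * u (Suc j) y - 1) - P j \<omega> * f y * (2 * u (Suc j) y - 1)"
        unfolding Pj by (simp add: algebra_simps)
      moreover have "0 \<le> P j \<omega> * f y * (2 * u (Suc j) y - 1)"
        using stop[of y "Suc j"] j P(1)[of j \<omega>] f(2)[of y] by (cases "f y = 0") simp_all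
      ultimately show ?thesis by linarith
    qed
    have "D (Suc j) \<le> F (\<lambda>\<omega>. 1 + P j \<omega> * (2 * u (Suc j) (S (Suc j) \<omega> - S n \<omega>) - 1))"
      unfolding D_def by (intro mono bD ptw) simp
    also have "\<dots> = F (\<lambda>\<omega>. F (\<lambda>\<omega>'. 1 + P j \<omega> * (2 * u (Suc j) (S j \<omega> - S n \<omega> + X (Suc j) \<omega>') - 1)))"
    proof -
      define p where "p = (\<lambda>v :: nat \<Rightarrow> real. \<Prod>k\<in>{n<..j}. 1 + (-1) * f (0 + (\<Sum>i\<in>{n..<k}. v i)))"
      define \<Phi> where "\<Phi> = (\<lambda>v. 1 + p v * (2 * u (Suc j) (0 + (\<Sum>k\<in>{n..<Suc j}. v k)) + (-1)))"
      have "\<Phi> \<in> C_b_Lip (j + 1)"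
        unfolding \<Phi>_def p_def
        by (intro C_b_Lip_add C_b_Lip_mult C_b_Lip_const C_b_Lip_prod C_b_Lip_sum f u) auto
      moreover have \<Phi>: "\<Phi> (vec_append j (\<lambda>i. X (i + 1) \<omega>) (\<lambda>_. z)) =
          1 + P j \<omega> * (2 * u (Suc j) (S j \<omega> - S n \<omega> + z) - 1)" for \<omega> z
      proof -
        have "(\<Sum>i\<in>{n..<k}. vec_append j (\<lambda>i. X (i + 1) \<omega>) (\<lambda>_. z) i) = S k \<omega> - S n \<omega>"
          if "n \<le> k" "k \<le> j" for k
          using that by (simp add: partial_sum_diff vec_append_def)
        then show ?thesis
          using j unfolding \<Phi>_def p_def P_def by (simp add: vec_append_def)
      qed
      moreover have "1 \<le> j" using assms j by simp
      moreover have "S (Suc j) \<omega> - S n \<omega> = S j \<omega> - S n \<omega> + X (j + 1) \<omega>" for \<omega>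
        by (simp add: partial_sum_Suc)
      ultimately show ?thesis
        using independent[of j \<Phi>] by (simp only: \<Phi> Suc_eq_plus1)
    qed
    also have "\<dots> = D j"
    proof -
      have "F (\<lambda>\<omega>'. 1 + P j \<omega> * (2 * u (Suc j) (y + X (Suc j) \<omega>') - 1)) = 1 + P j \<omega> * (2 * u j y - 1)"
        for \<omega> y
      proof -
        have "u j y = F (\<lambda>\<omega>. u (Suc j) (y + X (Suc j) \<omega>))"
          unfolding u_def using independent_increments[of "Suc j" j m \<rho> y] j \<rho>(1)
          by (simp add: partial_sum_Suc algebra_simps)
        moreover have "F (\<lambda>\<omega>'. (2 * P j \<omega>) * u (Suc j) (y + X (Suc j) \<omega>') + (1 - P j \<omega>))
            = (2 * P j \<omega>) * F (\<lambda>\<omega>'. u (Suc j) (y + X (Suc j) \<omega>')) + (1 - P j \<omega>)"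
          using P(1)[of j \<omega>] by (simp add: add_const scale bounded_fun_rules bu)
        ultimately show ?thesis by (simp add: algebra_simps)
      qed
      then show ?thesis by (simp add: D_def)
    qed
    finally show ?thesis .
  qed
  have "D j \<le> D n" if "n \<le> j" "j \<le> m" for j
    using that by (induction j rule: dec_induct) (auto intro: order_trans[OF decreasing])
  then have "D m \<le> D n" using \<open>n \<le> m\<close> by simp
  also have "D n = 2 * F (\<lambda>\<omega>. \<rho> (S m \<omega> - S n \<omega>))"
    by (simp add: D_def P_def u_def const)
  finally have "D m \<le> 2 * F (\<lambda>\<omega>. \<rho> (S m \<omega> - S n \<omega>))" .
  moreover have "F (indicator {\<omega>. \<exists>k\<in>{n<..m}. 2 / a \<le> \<bar>S k \<omega> - S n \<omega>\<bar>}) \<le> D m"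
    unfolding D_def
  proof (rule mono)
    fix \<omega>
    let ?R = "1 + P m \<omega> * (2 * u m (S m \<omega> - S n \<omega>) - 1)"
    show "indicator {\<omega>. \<exists>k\<in>{n<..m}. 2 / a \<le> \<bar>S k \<omega> - S n \<omega>\<bar>} \<omega> \<le> ?R"
    proof (cases "\<exists>k\<in>{n<..m}. 2 / a \<le> \<bar>S k \<omega> - S n \<omega>\<bar>")
      case True
      then obtain k where k: "k \<in> {n<..m}" "2 / a \<le> \<bar>S k \<omega> - S n \<omega>\<bar>" by blast
      have "2 \<le> \<bar>a * (S k \<omega> - S n \<omega>)\<bar>"
        using k(2) \<open>a > 0\<close> unfolding abs_mult by (simp add: pos_divide_le_eq mult.commute)
      then have "1 - f (S k \<omega> - S n \<omega>) = 0" by (simp add: f_def tail_cutoff_def)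
      then have "P m \<omega> = 0" unfolding P_def using k(1) by (intro prod_zero) auto
      then show ?thesis by simp
    next
      case False
      have "0 \<le> (1 - P m \<omega>) + 2 * (P m \<omega> * u m (S m \<omega> - S n \<omega>))" using P u by simp
      then show ?thesis using False by (simp add: algebra_simps)
    qed
  qed (intro bD bounded_fun_indicator_set)+
  ultimately show ?thesis unfolding \<rho>_def by linarith
qed

lemma oscillation_small:
  assumes Cauchy: "\<And>e \<delta>. 0 < e \<Longrightarrow> 0 < \<delta> \<Longrightarrow>
      \<exists>N\<ge>1. \<forall>n\<ge>N. \<forall>m\<ge>n. F (\<lambda>\<omega>. indicator {e..} \<bar>S m \<omega> - S n \<omega>\<bar>) < \<delta>"
    and "e > 0" "\<delta> > 0"
  shows "\<exists>N\<ge>1. \<forall>n\<ge>N. \<forall>m\<ge>n. F (indicator {\<omega>. \<exists>k\<in>{n<..m}. e \<le> \<bar>S k \<omega> - S n \<omega>\<bar>}) \<le> \<delta>"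
proof -
  define a where "a = 2 / e"
  define d where "d = min (\<delta> / 2) (1 / 2)"
  define \<eta> where "\<eta> = d / (2 * a)"
  have pos: "a > 0" "d > 0" "\<eta> > 0" using assms by (auto simp: a_def d_def \<eta>_def)
  obtain N where "1 \<le> N" and
    N: "\<forall>n\<ge>N. \<forall>m\<ge>n. F (\<lambda>\<omega>. indicator {\<eta>..} \<bar>S m \<omega> - S n \<omega>\<bar>) < d / 2"
    using Cauchy[of \<eta> "d / 2"] pos by auto
  have small: "F (\<lambda>\<omega>. tail_cutoff 0 (a * (S m \<omega> - S n \<omega>))) \<le> d" if "N \<le> n" "n \<le> m" for n m
  proof -
    have "tail_cutoff 0 (a * y) \<le> indicator {\<eta>..} \<bar>y\<bar> + d / 2" for y
    proof (cases "\<eta> \<le> \<bar>y\<bar>")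
      case False
      then have "a * \<bar>y\<bar> \<le> a * \<eta>" using pos by (intro mult_left_mono) auto
      also have "a * \<eta> = d / 2" using pos by (simp add: \<eta>_def)
      finally show ?thesis using False pos by (simp add: tail_cutoff_def abs_mult)
    qed (use pos tail_cutoff_bounds(2)[of 0 "a * y"] in simp)
    then have "F (\<lambda>\<omega>. tail_cutoff 0 (a * (S m \<omega> - S n \<omega>)))
        \<le> F (\<lambda>\<omega>. indicator {\<eta>..} \<bar>S m \<omega> - S n \<omega>\<bar>) + d / 2"
      by (intro le_add_const bounded_fun_tail_cutoff bounded_fun_indicator)
    then show ?thesis using N that by fastforce
  qed
  have "F (indicator {\<omega>. \<exists>k\<in>{n<..m}. e \<le> \<bar>S k \<omega> - S n \<omega>\<bar>}) \<le> \<delta>" if nm: "N \<le> n" "n \<le> m" for n m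
  proof -
    have "2 / a = e" by (simp add: a_def)
    moreover have "F (\<lambda>\<omega>. tail_cutoff 0 (a * (S m \<omega> - S k \<omega>))) \<le> 1 / 2"
      if "n \<le> k" "k \<le> m" for k
      using small[of k m] that nm by (simp add: d_def)
    ultimately have "F (indicator {\<omega>. \<exists>k\<in>{n<..m}. e \<le> \<bar>S k \<omega> - S n \<omega>\<bar>})
        \<le> 2 * F (\<lambda>\<omega>. tail_cutoff 0 (a * (S m \<omega> - S n \<omega>)))"
      using ottaviani[OF pos(1) _ nm(2)] \<open>1 \<le> N\<close> nm(1) by auto
    also have "\<dots> \<le> \<delta>" using small[OF nm] by (simp add: d_def)
    finally show ?thesis .
  qed
  then show ?thesis using \<open>1 \<le> N\<close> by blast
qed

end

section \<open>The upper expectation as a functional on bounded functions\<close>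

context sublinear_expectation_space
begin

text \<open>
  On bounded functions, whether or not they lie in \<open>H\<close>, the extended expectation is finite and
  inherits sub-linearity, so that capacities are the special case of indicators.
\<close>

definition upper_mean :: "('a \<Rightarrow> real) \<Rightarrow> real" where
  "upper_mean X = real_of_ereal (ext_expectation M H E X)"

lemma const_in_H: "(\<lambda>_. c) \<in> H"
proof -
  have "(\<lambda>_. c) \<in> C_l_Lip 0" by (auto simp: C_l_Lip_def intro: exI[of _ 1])
  then show ?thesis using H_closed[of "\<lambda>_. c" 0] by simp
qed

lemma ext_expectation_eq_Inf:
  "ext_expectation M H E X = Inf {E Y | Y. Y \<in> H \<and> (\<forall>\<omega>\<in>space M. X \<omega> \<le> Y \<omega>)}"
proof (cases "X \<in> H")
  case True
  then have "Inf {E Y | Y. Y \<in> H \<and> (\<forall>\<omega>\<in>space M. X \<omega> \<le> Y \<omega>)} = E X"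
    by (intro antisym Inf_lower Inf_greatest) (auto intro: E_mono)
  then show ?thesis using True by (simp add: ext_expectation_def)
qed (simp add: ext_expectation_def)

lemma ext_expectation_lower:
  "Y \<in> H \<Longrightarrow> (\<And>\<omega>. \<omega> \<in> space M \<Longrightarrow> X \<omega> \<le> Y \<omega>) \<Longrightarrow> ext_expectation M H E X \<le> E Y"
  unfolding ext_expectation_eq_Inf by (intro Inf_lower) blast

lemma ext_expectation_bounded:
  assumes "bounded_fun (space M) X"
  shows "ext_expectation M H E X = ereal (upper_mean X)"
proof -
  obtain B where B: "\<And>\<omega>. \<omega> \<in> space M \<Longrightarrow> \<bar>X \<omega>\<bar> \<le> B"
    using assms unfolding bounded_fun_def by blast
  have "ext_expectation M H E X \<le> ereal B"
    using ext_expectation_lower[OF const_in_H, of X B] B E_const by (auto simp: abs_le_iff)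
  moreover have "ereal (- B) \<le> ext_expectation M H E X"
    unfolding ext_expectation_eq_Inf
  proof (intro Inf_greatest, clarify)
    fix Y assume Y: "Y \<in> H" "\<forall>\<omega>\<in>space M. X \<omega> \<le> Y \<omega>"
    have "E (\<lambda>_. - B) \<le> E Y"
      using Y B by (intro E_mono const_in_H) (fastforce simp: abs_le_iff)+
    then show "ereal (- B) \<le> E Y" by (simp add: E_const)
  qed
  ultimately have "\<bar>ext_expectation M H E X\<bar> \<noteq> \<infinity>" by auto
  then show ?thesis unfolding upper_mean_def by (simp add: ereal_real')
qed

lemma upper_mean_le:
  assumes "bounded_fun (space M) X" "Y \<in> H" "\<And>\<omega>. \<omega> \<in> space M \<Longrightarrow> X \<omega> \<le> Y \<omega>"
  shows "ereal (upper_mean X) \<le> E Y"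
  using ext_expectation_lower[OF assms(2,3)] unfolding ext_expectation_bounded[OF assms(1)] .

lemma upper_mean_approx:
  assumes "bounded_fun (space M) X" "0 < \<eta>"
  obtains Y y where "Y \<in> H" "\<And>\<omega>. \<omega> \<in> space M \<Longrightarrow> X \<omega> \<le> Y \<omega>" "E Y = ereal y" "y < upper_mean X + \<eta>"
proof -
  have "Inf {E Y | Y. Y \<in> H \<and> (\<forall>\<omega>\<in>space M. X \<omega> \<le> Y \<omega>)} < ereal (upper_mean X + \<eta>)"
    using assms(2) unfolding ext_expectation_eq_Inf[symmetric] ext_expectation_bounded[OF assms(1)]
    by simp
  then obtain Y where Y: "Y \<in> H" "\<And>\<omega>. \<omega> \<in> space M \<Longrightarrow> X \<omega> \<le> Y \<omega>" "E Y < ereal (upper_mean X + \<eta>)"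
    unfolding Inf_less_iff by blast
  have "ereal (upper_mean X) \<le> E Y" by (rule upper_mean_le[OF assms(1) Y(1,2)])
  with Y(3) obtain y where "E Y = ereal y" by (cases "E Y") auto
  with Y that show thesis by simp
qed

lemma upper_mean_sublinear: "sublinear_functional (space M) upper_mean"
proof
  show "upper_mean (\<lambda>_. c) = c" for c
    unfolding upper_mean_def by (simp add: ext_expectation_def const_in_H E_const)
next
  fix X Y
  assume XY: "bounded_fun (space M) X" "bounded_fun (space M) Y"
    and le: "\<And>\<omega>. \<omega> \<in> space M \<Longrightarrow> X \<omega> \<le> Y \<omega>"
  show "upper_mean X \<le> upper_mean Y"
  proof (rule field_le_epsilon)
    fix \<eta> :: real assume "0 < \<eta>"
    then obtain Y' y where Y': "Y' \<in> H" "\<And>\<omega>. \<omega> \<in> space M \<Longrightarrow> Y \<omega> \<le> Y' \<omega>"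
        "E Y' = ereal y" "y < upper_mean Y + \<eta>"
      using upper_mean_approx[OF XY(2)] by blast
    have "ereal (upper_mean X) \<le> E Y'"
      by (rule upper_mean_le[OF XY(1) Y'(1)]) (use le Y'(2) order_trans in blast)
    then show "upper_mean X \<le> upper_mean Y + \<eta>" using Y'(3,4) by simp
  qed
next
  fix X Y
  assume X: "bounded_fun (space M) X" and Y: "bounded_fun (space M) Y"
  show "upper_mean (\<lambda>\<omega>. X \<omega> + Y \<omega>) \<le> upper_mean X + upper_mean Y"
  proof (rule field_le_epsilon)
    fix \<eta> :: real assume "0 < \<eta>"
    then have "0 < \<eta> / 2" by simp
    obtain X' x where X': "X' \<in> H" "\<And>\<omega>. \<omega> \<in> space M \<Longrightarrow> X \<omega> \<le> X' \<omega>"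
        "E X' = ereal x" "x < upper_mean X + \<eta> / 2"
      using upper_mean_approx[OF X \<open>0 < \<eta> / 2\<close>] by blast
    obtain Y' y where Y': "Y' \<in> H" "\<And>\<omega>. \<omega> \<in> space M \<Longrightarrow> Y \<omega> \<le> Y' \<omega>"
        "E Y' = ereal y" "y < upper_mean Y + \<eta> / 2"
      using upper_mean_approx[OF Y \<open>0 < \<eta> / 2\<close>] by blast
    have "ereal (upper_mean (\<lambda>\<omega>. X \<omega> + Y \<omega>)) \<le> E (\<lambda>\<omega>. X' \<omega> + Y' \<omega>)"
      using X'(1,2) Y'(1,2) by (intro upper_mean_le bounded_fun_add X Y H_add add_mono)
    also have "\<dots> \<le> E X' + E Y'" by (rule E_subadd) (simp_all add: X' Y')
    finally show "upper_mean (\<lambda>\<omega>. X \<omega> + Y \<omega>) \<le> upper_mean X + upper_mean Y + \<eta>"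
      using X'(3,4) Y'(3,4) by simp
  qed
next
  have le: "upper_mean (\<lambda>\<omega>. c * X \<omega>) \<le> c * upper_mean X"
    if X: "bounded_fun (space M) X" and c: "0 < c" for X and c :: real
  proof (rule field_le_epsilon)
    fix \<eta> :: real assume "0 < \<eta>"
    then have "0 < \<eta> / c" using c by simp
    obtain X' x where X': "X' \<in> H" "\<And>\<omega>. \<omega> \<in> space M \<Longrightarrow> X \<omega> \<le> X' \<omega>"
        "E X' = ereal x" "x < upper_mean X + \<eta> / c"
      using upper_mean_approx[OF X \<open>0 < \<eta> / c\<close>] by blast
    have "ereal (upper_mean (\<lambda>\<omega>. c * X \<omega>)) \<le> E (\<lambda>\<omega>. c * X' \<omega>)"
      using X'(1,2) c
      by (intro upper_mean_le bounded_fun_mult bounded_fun_const X H_scale mult_left_mono) auto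
    then have "upper_mean (\<lambda>\<omega>. c * X \<omega>) \<le> c * x"
      using c E_scale[OF X'(1), of c] X'(3) by simp
    also have "\<dots> \<le> c * (upper_mean X + \<eta> / c)" using c X'(4) by simp
    finally show "upper_mean (\<lambda>\<omega>. c * X \<omega>) \<le> c * upper_mean X + \<eta>"
      using c by (simp add: algebra_simps)
  qed
  fix X and c :: real
  assume X: "bounded_fun (space M) X" and "0 \<le> c"
  show "upper_mean (\<lambda>\<omega>. c * X \<omega>) = c * upper_mean X"
  proof (cases "c = 0")
    case True
    then show ?thesis by (simp add: upper_mean_def ext_expectation_def const_in_H E_const)
  next
    case False
    then have c: "0 < c" using \<open>0 \<le> c\<close> by simp
    have "upper_mean (\<lambda>\<omega>. inverse c * (c * X \<omega>)) \<le> inverse c * upper_mean (\<lambda>\<omega>. c * X \<omega>)"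
      using c by (intro le bounded_fun_mult bounded_fun_const X) simp
    then have "c * upper_mean X \<le> upper_mean (\<lambda>\<omega>. c * X \<omega>)"
      using c by (simp add: field_simps)
    with le[OF X c] show ?thesis by simp
  qed
qed

sublocale upper_mean: sublinear_functional "space M" upper_mean
  by (rule upper_mean_sublinear)

lemma upper_capacity_eq: "upper_capacity M H E A = ereal (upper_mean (indicator A))"
  using ext_expectation_bounded[OF bounded_fun_indicator_set, of A]
  unfolding ext_expectation_eq_Inf upper_capacity_def by simp

lemma tight_iff: "tight M H E L \<longleftrightarrow>
    ((\<lambda>x. upper_mean (indicator {\<omega> \<in> space M. \<bar>L \<omega>\<bar> > x})) \<longlongrightarrow> 0) at_top"
  unfolding tight_def upper_capacity_eq zero_ereal_def lim_ereal ..

lemma converges_in_capacity_iff: "converges_in_capacity M H E Z L \<longleftrightarrow>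
    (\<forall>e>0. (\<lambda>n. upper_mean (indicator {\<omega> \<in> space M. \<bar>Z n \<omega> - L \<omega>\<bar> \<ge> e})) \<longlonglongrightarrow> 0)"
  unfolding converges_in_capacity_def upper_capacity_eq zero_ereal_def lim_ereal ..

lemma upper_mean_indicator_nonneg: "0 \<le> upper_mean (indicator A)"
  by (rule upper_mean.ge_const[OF bounded_fun_indicator_set]) simp

lemma upper_mean_indicator_mono:
  "(\<And>\<omega>. \<omega> \<in> space M \<Longrightarrow> \<omega> \<in> A \<Longrightarrow> \<omega> \<in> B) \<Longrightarrow> upper_mean (indicator A) \<le> upper_mean (indicator B)"
  by (intro upper_mean.mono bounded_fun_indicator_set) (auto simp: indicator_def)

lemma upper_mean_indicator_Un:
  "(\<And>\<omega>. \<omega> \<in> space M \<Longrightarrow> \<omega> \<in> A \<Longrightarrow> \<omega> \<in> B \<or> \<omega> \<in> C) \<Longrightarrow>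
     upper_mean (indicator A) \<le> upper_mean (indicator B) + upper_mean (indicator C)"
  by (intro upper_mean.add_le bounded_fun_indicator_set) (auto simp: indicator_def)

text \<open>
  Convergence in capacity to a tight limit implies convergence of the laws: on a large compact
  interval the test function is uniformly continuous, and the rest has small capacity.
\<close>

lemma converges_in_capacity_imp_laws:
  assumes conv: "converges_in_capacity M H E Z L" and tight: "tight M H E L"
    and \<phi>: "\<phi> \<in> bcontfun"
  shows "(\<lambda>n. upper_mean (\<lambda>\<omega>. \<phi> (Z n \<omega>))) \<longlonglongrightarrow> upper_mean (\<lambda>\<omega>. \<phi> (L \<omega>))"
proof (rule LIMSEQ_I)
  fix r :: real assume "0 < r"
  obtain B' where B': "\<And>x. \<bar>\<phi> x\<bar> \<le> B'"
    using \<phi> unfolding bcontfun_def bounded_iff by auto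
  define B where "B = \<bar>B'\<bar> + 1"
  have "0 < B" by (simp add: B_def)
  have B: "\<bar>\<phi> x\<bar> \<le> B" for x using B'[of x] unfolding B_def by linarith
  define \<eta> where "\<eta> = r / (8 * B)"
  have "0 < \<eta>" using \<open>0 < r\<close> \<open>0 < B\<close> by (simp add: \<eta>_def)
  let ?far = "\<lambda>x. upper_mean (indicator {\<omega> \<in> space M. \<bar>L \<omega>\<bar> > x})"
  have "\<forall>\<^sub>F x in at_top. ?far x < \<eta>"
    using tight \<open>0 < \<eta>\<close> unfolding tight_iff by (rule order_tendstoD)
  then obtain x where x: "?far x < \<eta>"
    by (auto simp: eventually_at_top_linorder)
  let ?I = "{- x - 1..x + 1}"
  have "uniformly_continuous_on ?I \<phi>"
    using \<phi> unfolding bcontfun_def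
    by (auto intro!: compact_uniformly_continuous intro: continuous_on_subset)
  then obtain d where "0 < d" and d: "\<And>s t. s \<in> ?I \<Longrightarrow> t \<in> ?I \<Longrightarrow> \<bar>t - s\<bar> < d \<Longrightarrow> \<bar>\<phi> t - \<phi> s\<bar> < r / 2"
    unfolding uniformly_continuous_on_def dist_real_def using \<open>0 < r\<close> by (metis half_gt_zero)
  let ?off = "\<lambda>n. upper_mean (indicator {\<omega> \<in> space M. \<bar>Z n \<omega> - L \<omega>\<bar> \<ge> min d 1})"
  have "?off \<longlonglongrightarrow> 0"
    using conv \<open>0 < d\<close> unfolding converges_in_capacity_iff by simp
  then have "\<forall>\<^sub>F n in sequentially. ?off n < \<eta>"
    using \<open>0 < \<eta>\<close> by (rule order_tendstoD)
  then obtain N where N: "\<And>n. N \<le> n \<Longrightarrow> ?off n < \<eta>"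
    unfolding eventually_sequentially by blast
  show "\<exists>N. \<forall>n\<ge>N. norm (upper_mean (\<lambda>\<omega>. \<phi> (Z n \<omega>)) - upper_mean (\<lambda>\<omega>. \<phi> (L \<omega>))) < r"
  proof (intro exI[of _ N] allI impI)
    fix n assume "N \<le> n"
    let ?G = "{\<omega> \<in> space M. \<bar>Z n \<omega> - L \<omega>\<bar> \<ge> min d 1}"
    let ?K = "{\<omega> \<in> space M. \<bar>L \<omega>\<bar> > x}"
    define R where "R = (\<lambda>\<omega>. (2 * B) * (indicator ?G \<omega> + indicator ?K \<omega>) + r / 2 :: real)"
    have b\<phi>: "bounded_fun (space M) (\<lambda>\<omega>. \<phi> (Y \<omega>))" for Y by (rule bounded_funI[OF B])
    have bR: "bounded_fun (space M) R"
      unfolding R_def by (intro bounded_fun_rules bounded_fun_indicator_set)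
    have "\<bar>\<phi> (Z n \<omega>) - \<phi> (L \<omega>)\<bar> \<le> R \<omega>" if "\<omega> \<in> space M" for \<omega>
    proof (cases "\<omega> \<in> ?G \<union> ?K")
      case True
      then have "2 * B * 1 \<le> (2 * B) * (indicator ?G \<omega> + indicator ?K \<omega>)"
        using \<open>0 < B\<close> by (intro mult_left_mono) (auto simp: indicator_def)
      then show ?thesis
        unfolding R_def using B[of "Z n \<omega>"] B[of "L \<omega>"] \<open>0 < r\<close> by linarith
    next
      case False
      then have "\<bar>Z n \<omega> - L \<omega>\<bar> < min d 1" "\<bar>L \<omega>\<bar> \<le> x" using that by auto
      then have "\<bar>\<phi> (Z n \<omega>) - \<phi> (L \<omega>)\<bar> < r / 2" by (intro d) auto
      then show ?thesis using False by (simp add: R_def)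
    qed
    then have ptw: "\<phi> (Z n \<omega>) \<le> \<phi> (L \<omega>) + R \<omega>" "\<phi> (L \<omega>) \<le> \<phi> (Z n \<omega>) + R \<omega>"
      if "\<omega> \<in> space M" for \<omega>
      using that by (auto simp: abs_le_iff algebra_simps)
    have "upper_mean R = (2 * B) * upper_mean (\<lambda>\<omega>. indicator ?G \<omega> + indicator ?K \<omega>) + r / 2"
      unfolding R_def using \<open>0 < B\<close>
      by (simp add: upper_mean.add_const upper_mean.scale bounded_fun_rules bounded_fun_indicator_set)
    also have "\<dots> \<le> (2 * B) * (?off n + ?far x) + r / 2"
      using \<open>0 < B\<close> by (intro add_right_mono mult_left_mono upper_mean.subadd bounded_fun_indicator_set) auto
    also have "\<dots> < (2 * B) * (\<eta> + \<eta>) + r / 2"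
      using \<open>0 < B\<close> N[OF \<open>N \<le> n\<close>] x by (intro add_strict_right_mono mult_strict_left_mono) auto
    also have "\<dots> = r" using \<open>0 < B\<close> by (simp add: \<eta>_def)
    finally have "upper_mean R < r" .
    moreover have "upper_mean (\<lambda>\<omega>. \<phi> (Z n \<omega>)) \<le> upper_mean (\<lambda>\<omega>. \<phi> (L \<omega>)) + upper_mean R"
      "upper_mean (\<lambda>\<omega>. \<phi> (L \<omega>)) \<le> upper_mean (\<lambda>\<omega>. \<phi> (Z n \<omega>)) + upper_mean R"
      by (intro upper_mean.add_le b\<phi> bR ptw; assumption)+
    ultimately show "norm (upper_mean (\<lambda>\<omega>. \<phi> (Z n \<omega>)) - upper_mean (\<lambda>\<omega>. \<phi> (L \<omega>))) < r"
      by simp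
  qed
qed

end

section \<open>Almost sure convergence from small oscillations\<close>

text \<open>
  The oscillations over consecutive blocks add up to at most the tail of the geometric series,
  \<open>(1 / 2) ^ l + 2 * (1 / 2) ^ Suc l = 2 * (1 / 2) ^ l\<close>; the last block is the partial one
  containing \<open>k\<close>.
\<close>

lemma block_oscillation:
  fixes x :: "nat \<Rightarrow> real"
  assumes "strict_mono t"
    and blocks: "\<forall>l\<ge>i. \<forall>k\<in>{t l<..t (Suc l)}. \<bar>x k - x (t l)\<bar> < (1 / 2) ^ l"
    and "i \<le> l" "t l \<le> k"
  shows "\<bar>x k - x (t l)\<bar> \<le> 2 * (1 / 2) ^ l"
proof -
  have "\<bar>x k - x (t l)\<bar> \<le> 2 * (1 / 2) ^ l" if "i \<le> l" "t l \<le> k" "k \<le> t (l + p)" for p l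
    using that
  proof (induction p arbitrary: l)
    case 0
    then show ?case by simp
  next
    case (Suc p)
    consider "k = t l" | "k \<in> {t l<..t (Suc l)}" | "t (Suc l) \<le> k" using Suc.prems by force
    then show ?case
    proof cases
      case 2
      then have "\<bar>x k - x (t l)\<bar> < (1 / 2) ^ l" using blocks Suc.prems by blast
      moreover have "0 < (1 / 2 :: real) ^ l" by simp
      ultimately show ?thesis by linarith
    next
      case 3
      have "t (Suc l) \<in> {t l<..t (Suc l)}" using \<open>strict_mono t\<close> by (simp add: strict_mono_less)
      then have "\<bar>x (t (Suc l)) - x (t l)\<bar> < (1 / 2) ^ l" using blocks Suc.prems by blast
      moreover have "\<bar>x k - x (t (Suc l))\<bar> \<le> 2 * (1 / 2) ^ Suc l"
        using Suc.IH[of "Suc l"] Suc.prems 3 by simp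
      ultimately show ?thesis by simp
    qed simp
  qed
  moreover have "k \<le> t (l + k)"
    using strict_mono_imp_increasing[OF \<open>strict_mono t\<close>, of "l + k"] by linarith
  ultimately show ?thesis using assms(3,4) by blast
qed

lemma block_limit:
  fixes x :: "nat \<Rightarrow> real"
  assumes "strict_mono t"
    and blocks: "\<forall>l\<ge>i. \<forall>k\<in>{t l<..t (Suc l)}. \<bar>x k - x (t l)\<bar> < (1 / 2) ^ l"
  shows "convergent x" and "i \<le> l \<Longrightarrow> \<bar>lim x - x (t l)\<bar> \<le> 2 * (1 / 2) ^ l"
proof -
  note osc = block_oscillation[OF assms]
  have "Cauchy x"
  proof (rule metric_CauchyI)
    fix e :: real assume "0 < e"
    then obtain p where p: "(1 / 2 :: real) ^ p < e / 4"
      using real_arch_pow_inv[of "e / 4" "1 / 2"] by auto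
    define l where "l = max i p"
    have "(1 / 2 :: real) ^ l \<le> (1 / 2) ^ p" by (rule power_decreasing) (auto simp: l_def)
    then have l: "i \<le> l" "4 * (1 / 2 :: real) ^ l < e" using p by (linarith | simp add: l_def)+
    have "dist (x m) (x n) < e" if "t l \<le> m" "t l \<le> n" for m n
      using osc[OF l(1) that(1)] osc[OF l(1) that(2)] l(2) unfolding dist_real_def by linarith
    then show "\<exists>N. \<forall>m\<ge>N. \<forall>n\<ge>N. dist (x m) (x n) < e" by blast
  qed
  then show conv: "convergent x" by (rule Cauchy_convergent)
  assume "i \<le> l"
  have "(\<lambda>k. \<bar>x k - x (t l)\<bar>) \<longlonglongrightarrow> \<bar>lim x - x (t l)\<bar>"
    using conv by (intro tendsto_intros) (simp add: convergent_LIMSEQ_iff)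
  then show "\<bar>lim x - x (t l)\<bar> \<le> 2 * (1 / 2) ^ l"
    by (rule LIMSEQ_le_const2) (use osc[OF \<open>i \<le> l\<close>] in blast)
qed

context sublinear_expectation_space
begin

lemma upper_mean_tail_union:
  assumes "countably_sub_additive M (upper_capacity M H E)"
    and "\<And>l. B l \<in> sets M" "\<And>l. upper_mean (indicator (B l)) \<le> (1 / 2) ^ l"
  shows "upper_mean (indicator (\<Union>l. B (l + i))) \<le> 2 * (1 / 2) ^ i"
proof -
  have "upper_capacity M H E (\<Union>l. B (l + i)) \<le> (\<Sum>l. upper_capacity M H E (B (l + i)))"
    using assms(1)[unfolded countably_sub_additive_def, rule_format, of "\<lambda>l. B (l + i)"] assms(2)
    by auto
  also have "\<dots> \<le> (\<Sum>l. ereal ((1 / 2) ^ (l + i)))"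
    using assms(3) upper_mean_indicator_nonneg
    by (intro suminf_le_pos) (simp_all add: upper_capacity_eq)
  also have "\<dots> = ereal (2 * (1 / 2) ^ i)"
  proof -
    have "(\<lambda>l. (1 / 2 :: real) ^ l * (1 / 2) ^ i) sums (1 / (1 - 1 / 2) * (1 / 2) ^ i)"
      by (intro sums_mult2 geometric_sums) simp
    then have "(\<lambda>l. (1 / 2 :: real) ^ (l + i)) sums (2 * (1 / 2) ^ i)" by (simp add: power_add)
    then show ?thesis by (intro sums_unique[symmetric]) (simp add: sums_ereal)
  qed
  finally show ?thesis by (simp add: upper_capacity_eq)
qed

text \<open>
  A capacity need not be continuous along increasing sequences of events, so smallness of the
  maximum over \<open>{n<..m}\<close>, uniform in \<open>m\<close>, does not pass to the supremum over all \<open>k > n\<close>. A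
  Borel--Cantelli argument over consecutive finite blocks replaces that passage to the limit.
\<close>

lemma small_oscillation_convergence:
  assumes csa: "countably_sub_additive M (upper_capacity M H E)"
    and meas: "\<And>n. Z n \<in> borel_measurable M"
    and osc: "\<And>e \<delta>. 0 < e \<Longrightarrow> 0 < \<delta> \<Longrightarrow> \<exists>N\<ge>1. \<forall>n\<ge>N. \<forall>m\<ge>n.
        upper_mean (indicator {\<omega>. \<exists>k\<in>{n<..m}. e \<le> \<bar>Z k \<omega> - Z n \<omega>\<bar>}) \<le> \<delta>"
  defines "L \<equiv> \<lambda>\<omega>. lim (\<lambda>n. Z n \<omega>)"
  shows "converges_in_capacity M H E Z L"
    and "upper_capacity M H E {\<omega> \<in> space M. \<not> (\<lambda>n. Z n \<omega>) \<longlonglongrightarrow> L \<omega>} = 0"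
proof -
  have "\<forall>l. \<exists>N. \<forall>n\<ge>N. \<forall>m\<ge>n.
      upper_mean (indicator {\<omega>. \<exists>k\<in>{n<..m}. (1 / 2) ^ l \<le> \<bar>Z k \<omega> - Z n \<omega>\<bar>}) \<le> (1 / 2) ^ l"
  proof
    fix l
    show "\<exists>N. \<forall>n\<ge>N. \<forall>m\<ge>n.
        upper_mean (indicator {\<omega>. \<exists>k\<in>{n<..m}. (1 / 2) ^ l \<le> \<bar>Z k \<omega> - Z n \<omega>\<bar>}) \<le> (1 / 2) ^ l"
      using osc[of "(1 / 2) ^ l" "(1 / 2) ^ l"] by (auto simp only: zero_less_power zero_less_divide_1_iff zero_less_numeral)
  qed
  from choice[OF this] obtain N where N: "\<And>l n m. N l \<le> n \<Longrightarrow> n \<le> m \<Longrightarrow>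
      upper_mean (indicator {\<omega>. \<exists>k\<in>{n<..m}. (1 / 2) ^ l \<le> \<bar>Z k \<omega> - Z n \<omega>\<bar>}) \<le> (1 / 2) ^ l"
    by blast
  (* Summing makes the block boundaries strictly increasing while keeping them above N. *)
  define t where "t = (\<lambda>l. \<Sum>j\<le>l. Suc (N j))"
  have t: "strict_mono t" "N l \<le> t l" for l
  proof -
    show "strict_mono t" by (rule strict_monoI_Suc) (simp add: t_def)
    have "Suc (N l) \<le> t l" unfolding t_def by (rule member_le_sum) auto
    then show "N l \<le> t l" by simp
  qed
  define B where "B = (\<lambda>l. {\<omega> \<in> space M. \<exists>k\<in>{t l<..t (Suc l)}. (1 / 2) ^ l \<le> \<bar>Z k \<omega> - Z (t l) \<omega>\<bar>})"
  have "B l \<in> sets M" for l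
  proof -
    have "B l = (\<Union>k\<in>{t l<..t (Suc l)}. {\<omega> \<in> space M. (1 / 2) ^ l \<le> \<bar>Z k \<omega> - Z (t l) \<omega>\<bar>})"
      by (auto simp: B_def)
    also have "\<dots> \<in> sets M"
      using meas by (intro sets.finite_UN borel_measurable_le) auto
    finally show ?thesis .
  qed
  moreover have "upper_mean (indicator (B l)) \<le> (1 / 2) ^ l" for l
  proof -
    have "t l \<le> t (Suc l)" using t(1) by (simp add: strict_mono_less_eq)
    have "upper_mean (indicator (B l)) \<le>
        upper_mean (indicator {\<omega>. \<exists>k\<in>{t l<..t (Suc l)}. (1 / 2) ^ l \<le> \<bar>Z k \<omega> - Z (t l) \<omega>\<bar>})"
      by (rule upper_mean_indicator_mono) (simp add: B_def)
    also have "\<dots> \<le> (1 / 2) ^ l" by (rule N[OF t(2) \<open>t l \<le> t (Suc l)\<close>])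
    finally show ?thesis .
  qed
  ultimately have tail: "upper_mean (indicator (\<Union>l. B (l + i))) \<le> 2 * (1 / 2) ^ i" for i
    by (rule upper_mean_tail_union[OF csa])
  have good: "convergent (\<lambda>n. Z n \<omega>)" "i \<le> l \<Longrightarrow> \<bar>L \<omega> - Z (t l) \<omega>\<bar> \<le> 2 * (1 / 2) ^ l"
    if "\<omega> \<in> space M" "\<omega> \<notin> (\<Union>l. B (l + i))" for \<omega> i l
  proof -
    have "\<forall>l\<ge>i. \<forall>k\<in>{t l<..t (Suc l)}. \<bar>Z k \<omega> - Z (t l) \<omega>\<bar> < (1 / 2) ^ l"
    proof (intro allI impI ballI, rule ccontr)
      fix l k assume lk: "i \<le> l" "k \<in> {t l<..t (Suc l)}"
      assume "\<not> \<bar>Z k \<omega> - Z (t l) \<omega>\<bar> < (1 / 2) ^ l"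
      then have "\<omega> \<in> B (l - i + i)" using lk \<open>\<omega> \<in> space M\<close> by (auto simp: B_def not_less)
      then show False using \<open>\<omega> \<notin> (\<Union>l. B (l + i))\<close> by blast
    qed
    note * = block_limit[of t i "\<lambda>n. Z n \<omega>", OF t(1) this]
    show "convergent (\<lambda>n. Z n \<omega>)" by (rule *(1))
    show "\<bar>L \<omega> - Z (t l) \<omega>\<bar> \<le> 2 * (1 / 2) ^ l" if "i \<le> l" unfolding L_def by (rule *(2)[OF that])
  qed
  have small: "\<exists>i. 2 * (1 / 2) ^ i < e" if "0 < e" for e :: real
  proof -
    obtain i where "(1 / 2) ^ i < e / 2" using real_arch_pow_inv[of "e / 2" "1 / 2"] \<open>0 < e\<close> by auto
    then show ?thesis by (intro exI[of _ i]) linarith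
  qed
  show "upper_capacity M H E {\<omega> \<in> space M. \<not> (\<lambda>n. Z n \<omega>) \<longlonglongrightarrow> L \<omega>} = 0" (is "upper_capacity M H E ?D = 0")
  proof -
    have "upper_mean (indicator ?D) \<le> e" if "0 < e" for e
    proof -
      obtain i where i: "2 * (1 / 2) ^ i < e" using small[OF \<open>0 < e\<close>] by blast
      have "upper_mean (indicator ?D) \<le> upper_mean (indicator (\<Union>l. B (l + i)))"
        using good(1)[of _ i] unfolding L_def convergent_LIMSEQ_iff
        by (intro upper_mean_indicator_mono) blast
      then show ?thesis using tail[of i] i by linarith
    qed
    then have "upper_mean (indicator ?D) \<le> 0" by (rule field_le_epsilon[of _ 0, simplified])
    then show ?thesis
      using upper_mean_indicator_nonneg[of ?D] by (simp add: upper_capacity_eq zero_ereal_def)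
  qed
  show "converges_in_capacity M H E Z L"
    unfolding converges_in_capacity_iff
  proof (intro allI impI LIMSEQ_I)
    fix e r :: real assume "0 < e" "0 < r"
    let ?off = "\<lambda>n. {\<omega> \<in> space M. \<bar>Z n \<omega> - L \<omega>\<bar> \<ge> e}"
    obtain i where i: "2 * (1 / 2) ^ i < min (e / 2) (r / 2)"
      using small[of "min (e / 2) (r / 2)"] \<open>0 < e\<close> \<open>0 < r\<close> by auto
    obtain N' where N': "\<forall>n\<ge>N'. \<forall>m\<ge>n.
        upper_mean (indicator {\<omega>. \<exists>k\<in>{n<..m}. e / 2 \<le> \<bar>Z k \<omega> - Z n \<omega>\<bar>}) \<le> r / 2"
      using osc[of "e / 2" "r / 2"] \<open>0 < e\<close> \<open>0 < r\<close> by auto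
    have "upper_mean (indicator (?off n)) < r" if "N' \<le> n" for n
    proof -
      define l where "l = i + n"
      have "n \<le> t l" using strict_mono_imp_increasing[OF t(1), of l] by (simp add: l_def)
      let ?osc = "{\<omega>. \<exists>k\<in>{n<..t l}. e / 2 \<le> \<bar>Z k \<omega> - Z n \<omega>\<bar>}"
      have "\<omega> \<in> ?osc \<or> \<omega> \<in> (\<Union>l. B (l + i))" if "\<omega> \<in> space M" "\<omega> \<in> ?off n" for \<omega>
      proof (rule disjCI)
        assume "\<omega> \<notin> (\<Union>l. B (l + i))"
        then have "\<bar>L \<omega> - Z (t l) \<omega>\<bar> \<le> 2 * (1 / 2) ^ l"
          using good(2)[OF that(1)] by (simp add: l_def)
        also have "\<dots> \<le> 2 * (1 / 2) ^ i"
          by (intro mult_left_mono power_decreasing) (auto simp: l_def)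
        finally have "\<bar>L \<omega> - Z (t l) \<omega>\<bar> < e / 2" using i by simp
        moreover have "e \<le> \<bar>Z n \<omega> - L \<omega>\<bar>" using that(2) by simp
        ultimately have "e / 2 \<le> \<bar>Z (t l) \<omega> - Z n \<omega>\<bar>" by linarith
        moreover from this have "t l \<noteq> n" using \<open>0 < e\<close> by auto
        ultimately show "\<omega> \<in> ?osc" using \<open>n \<le> t l\<close> by fastforce
      qed
      then have "upper_mean (indicator (?off n))
          \<le> upper_mean (indicator ?osc) + upper_mean (indicator (\<Union>l. B (l + i)))"
        by (rule upper_mean_indicator_Un)
      moreover have "upper_mean (indicator ?osc) \<le> r / 2" using N' that \<open>n \<le> t l\<close> by blast
      ultimately show ?thesis using tail[of i] i by simp
    qed
    then show "\<exists>N. \<forall>n\<ge>N. norm (upper_mean (indicator (?off n)) - 0) < r"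
      using upper_mean_indicator_nonneg by (intro exI[of _ N']) simp
  qed
qed

lemma converges_in_capacity_tight:
  assumes "converges_in_capacity M H E Z L"
    and tight: "\<And>\<eta>. 0 < \<eta> \<Longrightarrow>
      \<exists>K\<ge>0. \<forall>\<^sub>F n in sequentially. upper_mean (\<lambda>\<omega>. tail_cutoff K (Z n \<omega>)) \<le> \<eta>"
  shows "tight M H E L"
  unfolding tight_iff
proof (rule tendstoI)
  fix e :: real assume "0 < e"
  let ?off = "\<lambda>n. {\<omega> \<in> space M. \<bar>Z n \<omega> - L \<omega>\<bar> \<ge> 1}"
  let ?far = "\<lambda>x. {\<omega> \<in> space M. \<bar>L \<omega>\<bar> > x}"
  obtain K where K: "\<forall>\<^sub>F n in sequentially. upper_mean (\<lambda>\<omega>. tail_cutoff K (Z n \<omega>)) \<le> e / 2"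
    using tight[of "e / 2"] \<open>0 < e\<close> by auto
  have "(\<lambda>n. upper_mean (indicator (?off n))) \<longlonglongrightarrow> 0"
    using assms(1) unfolding converges_in_capacity_iff by simp
  then have "\<forall>\<^sub>F n in sequentially. upper_mean (indicator (?off n)) < e / 2"
    by (rule order_tendstoD) (use \<open>0 < e\<close> in simp)
  then have "\<forall>\<^sub>F n in sequentially. upper_mean (\<lambda>\<omega>. tail_cutoff K (Z n \<omega>)) \<le> e / 2 \<and>
      upper_mean (indicator (?off n)) < e / 2"
    using K by (rule eventually_conj[rotated])
  then obtain n where n: "upper_mean (\<lambda>\<omega>. tail_cutoff K (Z n \<omega>)) \<le> e / 2"
      "upper_mean (indicator (?off n)) < e / 2"
    using eventually_happens'[OF sequentially_bot] by blast
  have "upper_mean (indicator (?far x)) < e" if "K + 2 \<le> x" for x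
  proof -
    have "upper_mean (indicator (?far x))
        \<le> upper_mean (\<lambda>\<omega>. tail_cutoff K (Z n \<omega>)) + upper_mean (indicator (?off n))"
    proof (rule upper_mean.add_le)
      fix \<omega> assume \<omega>: "\<omega> \<in> space M"
      have "tail_cutoff K (Z n \<omega>) = 1" if "\<omega> \<in> ?far x" "\<omega> \<notin> ?off n"
      proof -
        have "K + 1 \<le> \<bar>Z n \<omega>\<bar>" using that \<omega> \<open>K + 2 \<le> x\<close> by auto
        then show ?thesis by (simp add: tail_cutoff_def)
      qed
      moreover have "0 \<le> tail_cutoff K (Z n \<omega>)" by (rule tail_cutoff_bounds)
      ultimately show "indicator (?far x) \<omega> \<le> tail_cutoff K (Z n \<omega>) + indicator (?off n) \<omega>"
        by (cases "\<omega> \<in> ?far x"; cases "\<omega> \<in> ?off n") simp_all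
    qed (intro bounded_fun_indicator_set bounded_fun_tail_cutoff)+
    then show ?thesis using n by linarith
  qed
  then show "\<forall>\<^sub>F x in at_top. dist (upper_mean (indicator (?far x))) 0 < e"
    using upper_mean_indicator_nonneg
    by (auto simp: eventually_at_top_linorder dist_real_def intro!: exI[of _ "K + 2"])
qed

end

section \<open>Convergence of sums of independent random variables\<close>

theorem theorem3p2:
  fixes M :: "'a measure" and H :: "('a \<Rightarrow> real) set" and E :: "('a \<Rightarrow> real) \<Rightarrow> ereal"
    and X :: "nat \<Rightarrow> 'a \<Rightarrow> real"
  assumes "sublinear_expectation_space M H E"
    and "independent_seq M H E X"
  shows
    "(\<forall>S \<in> borel_measurable M.
        converges_in_capacity M H E (partial_sum X) S \<and> tight M H E S \<longrightarrow>
        (\<forall>\<phi> \<in> (bcontfun :: (real \<Rightarrow> real) set).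
           (\<lambda>n. ext_expectation M H E (\<lambda>\<omega>. \<phi> (partial_sum X n \<omega>)))
             \<longlonglongrightarrow> ext_expectation M H E (\<lambda>\<omega>. \<phi> (S \<omega>))))
     \<and>
     (\<forall>(M' :: 'b measure) H' E' S'.
        sublinear_expectation_space M' H' E' \<and> S' \<in> borel_measurable M' \<and> tight M' H' E' S' \<and>
        (\<forall>\<phi> \<in> (bcontfun :: (real \<Rightarrow> real) set).
           (\<lambda>n. ext_expectation M H E (\<lambda>\<omega>. \<phi> (partial_sum X n \<omega>)))
             \<longlonglongrightarrow> ext_expectation M' H' E' (\<lambda>\<omega>. \<phi> (S' \<omega>))) \<longrightarrow>
        Cauchy_in_capacity M H E (partial_sum X) \<and>
        (countably_sub_additive M (upper_capacity M H E) \<longrightarrow>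
           (\<exists>S \<in> borel_measurable M.
              tight M H E S \<and> converges_in_capacity M H E (partial_sum X) S \<and>
              upper_capacity M H E
                {\<omega> \<in> space M. \<not> (\<lambda>n. partial_sum X n \<omega>) \<longlonglongrightarrow> S \<omega>} = 0)))"
proof -
  interpret sublinear_expectation_space M H E by (rule assms(1))
  have H: "X n \<in> H" if "1 \<le> n" for n
    using assms(2) that unfolding independent_seq_def by blast
  interpret independent_sums "space M" upper_mean X
  proof
    fix i :: nat and \<Phi> assume "1 \<le> i" "\<Phi> \<in> C_b_Lip (i + 1)"
    then have "ext_expectation M H E (\<lambda>\<omega>. \<Phi> (vec_append i (\<lambda>j. X (j + 1) \<omega>) (\<lambda>_. X (i + 1) \<omega>))) =
        ext_expectation M H E (\<lambda>\<omega>. upper_mean (\<lambda>\<omega>'. \<Phi> (vec_append i (\<lambda>j. X (j + 1) \<omega>) (\<lambda>_. X (i + 1) \<omega>'))))"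
      using assms(2) unfolding independent_seq_def independent_to_def upper_mean_def by blast
    from arg_cong[OF this, of real_of_ereal]
    show "upper_mean (\<lambda>\<omega>. \<Phi> (vec_append i (\<lambda>j. X (j + 1) \<omega>) (\<lambda>_. X (i + 1) \<omega>))) =
        upper_mean (\<lambda>\<omega>. upper_mean (\<lambda>\<omega>'. \<Phi> (vec_append i (\<lambda>j. X (j + 1) \<omega>) (\<lambda>_. X (i + 1) \<omega>'))))"
      unfolding upper_mean_def .
  qed
  have S_meas: "S n \<in> borel_measurable M" for n
    unfolding partial_sum_def using H H_measurable by (intro borel_measurable_sum) auto
  have laws: "ext_expectation M H E (\<lambda>\<omega>. \<phi> (Y \<omega>)) = ereal (upper_mean (\<lambda>\<omega>. \<phi> (Y \<omega>)))"
    if "\<phi> \<in> bcontfun" for \<phi> :: "real \<Rightarrow> real" and Y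
    using that by (intro ext_expectation_bounded bcontfun_bounded_fun)
  show ?thesis
  proof (intro conjI ballI allI impI; (elim conjE)?)
    fix L and \<phi> :: "real \<Rightarrow> real"
    assume "converges_in_capacity M H E S L" "tight M H E L" "\<phi> \<in> bcontfun"
    then show "(\<lambda>n. ext_expectation M H E (\<lambda>\<omega>. \<phi> (S n \<omega>))) \<longlonglongrightarrow> ext_expectation M H E (\<lambda>\<omega>. \<phi> (L \<omega>))"
      using converges_in_capacity_imp_laws by (simp add: laws)
  next
    fix M' :: "'b measure" and H' E' S'
    assume "sublinear_expectation_space M' H' E'" and tight': "tight M' H' E' S'"
      and conv: "\<forall>\<phi> \<in> (bcontfun :: (real \<Rightarrow> real) set).
        (\<lambda>n. ext_expectation M H E (\<lambda>\<omega>. \<phi> (S n \<omega>))) \<longlonglongrightarrow> ext_expectation M' H' E' (\<lambda>\<omega>. \<phi> (S' \<omega>))"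
    then interpret limit: sublinear_expectation_space M' H' E' by simp
    have law_conv: "(\<lambda>n. upper_mean (\<lambda>\<omega>. \<phi> (S n \<omega>))) \<longlonglongrightarrow> limit.upper_mean (\<lambda>\<omega>. \<phi> (S' \<omega>))"
      if "bounded_lipschitz \<phi>" for \<phi>
      using bspec[OF conv bounded_lipschitz_bcontfun[OF that]]
        limit.ext_expectation_bounded[OF bounded_lipschitz_bounded_fun[OF that], of S']
      by (simp add: laws bounded_lipschitz_bcontfun[OF that])
    have laws_tight: "\<exists>K\<ge>0. \<forall>\<^sub>F n in sequentially. upper_mean (\<lambda>\<omega>. tail_cutoff K (S n \<omega>)) \<le> \<eta>"
      if "0 < \<eta>" for \<eta>
    proof -
      let ?far = "\<lambda>x. {\<omega> \<in> space M'. \<bar>S' \<omega>\<bar> > x}"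
      have "\<forall>\<^sub>F x in at_top. limit.upper_mean (indicator (?far x)) < \<eta>"
        using tight' \<open>0 < \<eta>\<close> unfolding limit.tight_iff by (rule order_tendstoD)
      then obtain K where K: "0 \<le> K" "limit.upper_mean (indicator (?far K)) < \<eta>"
        unfolding eventually_at_top_linorder by (meson max.cobounded1 max.cobounded2)
      have "limit.upper_mean (\<lambda>\<omega>. tail_cutoff K (S' \<omega>)) \<le> limit.upper_mean (indicator (?far K))"
        by (intro limit.upper_mean.mono bounded_fun_tail_cutoff bounded_fun_indicator_set)
          (auto simp: tail_cutoff_def indicator_def)
      then have "limit.upper_mean (\<lambda>\<omega>. tail_cutoff K (S' \<omega>)) < \<eta>" using K by simp
      then have "\<forall>\<^sub>F n in sequentially. upper_mean (\<lambda>\<omega>. tail_cutoff K (S n \<omega>)) < \<eta>"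
        by (rule order_tendstoD(2)[OF law_conv[OF bounded_lipschitz_tail_cutoff]])
      then show ?thesis using K(1) by (auto elim!: eventually_mono)
    qed
    interpret convergent_laws "space M" upper_mean S
    proof
      show "upper_mean (\<lambda>\<omega>. \<phi> (S m \<omega>)) = upper_mean (\<lambda>\<omega>. upper_mean (\<lambda>\<omega>'. \<phi> (S n \<omega> + (S m \<omega>' - S n \<omega>'))))"
        if "1 \<le> n" "n \<le> m" "bounded_lipschitz \<phi>" for n m \<phi>
        (* The block before the increment is the whole sum, because the sum of index 0 vanishes. *)
        using independent_increments[OF that(1) _ that(2,3), of 0 0] by (simp add: partial_sum_def)
      show "Cauchy (\<lambda>n. upper_mean (\<lambda>\<omega>. \<phi> (S n \<omega>)))" if "bounded_lipschitz \<phi>" for \<phi>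
        by (rule LIMSEQ_imp_Cauchy[OF law_conv[OF that]])
    qed (rule laws_tight)
    show "Cauchy_in_capacity M H E S"
      unfolding Cauchy_in_capacity_def
    proof (intro allI impI)
      fix e :: real assume "0 < e"
      let ?c = "\<lambda>n m. upper_mean (indicator {\<omega> \<in> space M. \<bar>S n \<omega> - S m \<omega>\<bar> \<ge> e})"
      have "((\<lambda>(n, m). ?c n m) \<longlongrightarrow> 0) (sequentially \<times>\<^sub>F sequentially)"
      proof (rule tendstoI)
        fix \<delta> :: real assume "0 < \<delta>"
        obtain N where N: "\<forall>n\<ge>N. \<forall>m\<ge>n. upper_mean (\<lambda>\<omega>. indicator {e..} \<bar>S m \<omega> - S n \<omega>\<bar>) < \<delta>"
          using increments_small[OF \<open>0 < e\<close> \<open>0 < \<delta>\<close>] by blast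
        have ordered: "?c m n < \<delta>" if "N \<le> n" "n \<le> m" for n m
        proof -
          have "?c m n = upper_mean (\<lambda>\<omega>. indicator {e..} \<bar>S m \<omega> - S n \<omega>\<bar>)"
            by (intro upper_mean.cong bounded_fun_indicator_set) (simp add: indicator_def)
          then show ?thesis using N that by simp
        qed
        have "?c n m < \<delta>" if "N \<le> n" "N \<le> m" for n m
        proof (cases "n \<le> m")
          case True
          then show ?thesis using ordered[OF that(1)] by (simp add: abs_minus_commute)
        next
          case False
          then show ?thesis using ordered[OF that(2)] by simp
        qed
        then show "\<forall>\<^sub>F p in sequentially \<times>\<^sub>F sequentially. dist (case p of (n, m) \<Rightarrow> ?c n m) 0 < \<delta>"
          using upper_mean_indicator_nonneg
          by (auto simp: eventually_prod_sequentially intro!: exI[of _ N])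
      qed
      then have "((\<lambda>p. ereal (case p of (n, m) \<Rightarrow> ?c n m)) \<longlongrightarrow> ereal 0) (sequentially \<times>\<^sub>F sequentially)"
        by (rule tendsto_ereal)
      then show "((\<lambda>(n, m). upper_capacity M H E {\<omega> \<in> space M. \<bar>S n \<omega> - S m \<omega>\<bar> \<ge> e}) \<longlongrightarrow> 0)
          (sequentially \<times>\<^sub>F sequentially)"
        by (simp add: upper_capacity_eq case_prod_unfold zero_ereal_def)
    qed
    assume csa: "countably_sub_additive M (upper_capacity M H E)"
    note limit_exists = small_oscillation_convergence[OF csa S_meas oscillation_small[OF increments_small]]
    show "\<exists>L\<in>borel_measurable M. tight M H E L \<and> converges_in_capacity M H E S L \<and>
        upper_capacity M H E {\<omega> \<in> space M. \<not> (\<lambda>n. S n \<omega>) \<longlonglongrightarrow> L \<omega>} = 0"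
    proof (intro bexI[of _ "\<lambda>\<omega>. lim (\<lambda>n. S n \<omega>)"] conjI)
      show "converges_in_capacity M H E S (\<lambda>\<omega>. lim (\<lambda>n. S n \<omega>))"
        by (rule limit_exists(1))
      then show "tight M H E (\<lambda>\<omega>. lim (\<lambda>n. S n \<omega>))"
        by (rule converges_in_capacity_tight[OF _ laws_tight])
      show "upper_capacity M H E {\<omega> \<in> space M. \<not> (\<lambda>n. S n \<omega>) \<longlonglongrightarrow> lim (\<lambda>n. S n \<omega>)} = 0"
        by (rule limit_exists(2))
    qed (intro borel_measurable_lim_metric S_meas)
  qed
qed

end
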